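(* Let $\{a,b\}$ and $\{c,d\}$ be independent sets in a graph $G$ such that $\{c,d\}$ can be reached from $\{a,b\}$ by token sliding. Then $\{c,d\}$ can be reached from $\{a,b\}$ by a reconfiguration sequence that visits every vertex at most $4$ times; that is, there is a reconfiguration sequence $I_1,\ldots,I_k$ with $I_1=\{a,b\}$ and $I_k=\{c,d\}$ such that, with $I_0=\emptyset$, for every $u\in V(G)$ we have $\sum_{i=1}^{k}|(I_i\setminus I_{i-1})\cap\{u\}|\le 4$.
   Context: All graphs are finite, undirected and simple. When an independent set is written $\{a,b\}$ (or $\{c,d\}$), its two elements are understood to be distinct (and nonadjacent). For independent sets $I,I'$ of $G$, $I'$ is obtained from $I$ in one step if $I\setminus I'=\{p\}$, $I'\setminus I=\{q\}$ and $pq\in E(G)$ for some vertices $p,q$. A reconfiguration sequence from $I$ to $I'$ is a finite sequence of independent sets $I=I_1,I_2,\ldots,I_k=I'$ ($k\ge 1$) in which each $I_i$ ($i\ge 2$) is obtained from $I_{i-1}$ in one step. $I'$ can be reached from $I$ by token sliding if such a sequence exists. *)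

theory Defs
  imports "Graph_Theory.Pair_Digraph"
begin

text \<open>
  A finite simple undirected graph is a \<^locale>\<open>pair_graph\<close>: a finite vertex set
  together with a symmetric, irreflexive set of ordered pairs of vertices. The edge
  \<open>uv\<close> is present iff \<open>(u, v) \<in> parcs G\<close>, equivalently \<open>(v, u) \<in> parcs G\<close>.
\<close>

definition independent_set :: "'a pair_pre_digraph \<Rightarrow> 'a set \<Rightarrow> bool" where
  "independent_set G I \<longleftrightarrow> I \<subseteq> pverts G \<and> (\<forall>u\<in>I. \<forall>v\<in>I. (u, v) \<notin> parcs G)"

definition slide_step :: "'a pair_pre_digraph \<Rightarrow> 'a set \<Rightarrow> 'a set \<Rightarrow> bool" where
  "slide_step G I I' \<longleftrightarrow> (\<exists>p q. I - I' = {p} \<and> I' - I = {q} \<and> (p, q) \<in> parcs G)"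

definition reconf_seq :: "'a pair_pre_digraph \<Rightarrow> 'a set \<Rightarrow> 'a set \<Rightarrow> 'a set list \<Rightarrow> bool" where
  "reconf_seq G I I' Is \<longleftrightarrow>
     Is \<noteq> [] \<and> hd Is = I \<and> last Is = I' \<and>
     (\<forall>J\<in>set Is. independent_set G J) \<and> successively (slide_step G) Is"

definition ts_reachable :: "'a pair_pre_digraph \<Rightarrow> 'a set \<Rightarrow> 'a set \<Rightarrow> bool" where
  "ts_reachable G I I' \<longleftrightarrow> (\<exists>Is. reconf_seq G I I' Is)"

text \<open>
  Lists are indexed from 0, so the set preceding \<open>Is ! i\<close> is \<open>({} # Is) ! i\<close>; for
  \<open>i = 0\<close> this is the empty set, hence the vertices of the initial set count as visited.
\<close>

definition visits :: "'a set list \<Rightarrow> 'a \<Rightarrow> nat" where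
  "visits Is u = (\<Sum>i<length Is. card ((Is ! i - ({} # Is) ! i) \<inter> {u}))"

end

theory Submission
  imports Defs
begin

text \<open>
  Group a reconfiguration sequence into \<^emph>\<open>phases\<close>: maximal stretches in which one token stays parked.
  If the positions where the tokens are parked are \<open>z 1, \<dots>, z m\<close>, then in phase \<open>i\<close> the other token
  moves from \<open>z (i - 1)\<close> to \<open>z (i + 1)\<close> within one component of \<open>G - N[z i]\<close>, and conversely any
  such sequence \<open>z\<close> can be realised, each phase by a shortest path. Among all of them take one with
  the fewest phases and, among these, with the lexicographically least list of path lengths. A
  phase visits a vertex at most once, so it remains to show that the paths of at most four phases
  contain a given \<open>u\<close>.

  Few phases mean that two phases which are far apart cannot be linked directly. Suppose that
  phases \<open>i\<close> and \<open>j\<close> both have access to \<open>u\<close>. If \<open>z i\<close> and \<open>z j\<close> lie in the same component of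
  \<open>G - N[u]\<close>, a token parked at \<open>u\<close> links the phases, so they differ by at most two
  (\<open>same_close\<close>). Otherwise both phases could have the tokens at \<open>z i\<close> and \<open>z j\<close>, so that they differ
  by at most one, unless one of \<open>z i\<close>, \<open>z j\<close> is adjacent to all vertices of \<open>N(u)\<close> that lead into the
  component of the other one (\<open>comparable\<close>). So to each phase with access to \<open>u\<close> belongs a pair of
  subsets of \<open>N(u)\<close>, the neighbours of \<open>z i\<close> and the neighbours of the component of \<open>z i\<close>, and for
  phases far apart one of these "intervals" lies entirely below the other.

  The set of vertices below a given such phase can be left only through a part of \<open>N(u)\<close>, and a
  step through it puts the tokens into a position from which the given phase is directly accessible
  (\<open>low_crossing_close\<close>, \<open>high_crossing_close\<close>). So this set becomes occupied or vacated only near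
  that phase. Consequently, of three phases \<open>l < k < j\<close> far apart the middle one is also the middle
  one in the order of the intervals (\<open>middle_between\<close>), say \<open>l\<close> lies below \<open>k\<close> and \<open>k\<close> below \<open>j\<close>.
  The tokens must then climb out of the part below \<open>k\<close> immediately before phase \<open>k\<close> and into the part
  above it immediately afterwards. This determines where the moving token of phase \<open>k\<close> starts
  (\<open>rise_before\<close>) and stops (\<open>rise_after\<close>) so closely that, if its shortest path went through \<open>u\<close>,
  some phases could be saved (\<open>not_on_path_between\<close>).

  Finally, three consecutive phases never visit \<open>u\<close>: parking a token at \<open>u\<close> in the middle one would
  give a lexicographically smaller list of lengths (\<open>not_three_consecutive\<close>). Hence among five visits
  the first, third and fifth are pairwise at least three phases apart, which is impossible.
\<close>

section \<open>Components of a graph without a closed neighbourhood\<close>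

locale simple_graph =
  fixes adj :: "'a \<Rightarrow> 'a \<Rightarrow> bool"
  assumes adj_sym: "adj x y \<Longrightarrow> adj y x"
    and adj_irrefl: "\<not> adj x x"
begin

text \<open>
  Closed neighbourhoods: a token parked at \<open>w\<close> keeps the other token out of exactly these vertices.
\<close>

definition near :: "'a \<Rightarrow> 'a \<Rightarrow> bool" where
  "near w x \<longleftrightarrow> x = w \<or> adj w x"

definition hop :: "'a \<Rightarrow> 'a \<Rightarrow> 'a \<Rightarrow> bool" where
  "hop w x y \<longleftrightarrow> adj x y \<and> \<not> near w x \<and> \<not> near w y"

text \<open>
  The vertices \<open>x\<close> and \<open>y\<close> lie in the same component of \<open>G - N[w]\<close>: a token can move from \<open>x\<close> to \<open>y\<close>
  while the other one is parked at \<open>w\<close>.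
\<close>

definition joined :: "'a \<Rightarrow> 'a \<Rightarrow> 'a \<Rightarrow> bool" where
  "joined w x y \<longleftrightarrow> \<not> near w x \<and> (hop w)\<^sup>*\<^sup>* x y"

text \<open>
  Between \<open>u\<close> and the component of \<open>y\<close> in \<open>G - N[u]\<close> every path uses a gate, and a token parked at \<open>y\<close>
  makes the blocked ones unusable.
\<close>

definition gate :: "'a \<Rightarrow> 'a \<Rightarrow> 'a set" where
  "gate u y = {p. adj u p \<and> (\<exists>y'. joined u y y' \<and> adj p y')}"

definition block :: "'a \<Rightarrow> 'a \<Rightarrow> 'a set" where
  "block u y = {p. adj u p \<and> adj p y}"

lemma near_commute: "near w x \<longleftrightarrow> near x w"
  by (auto simp: near_def adj_sym)

lemma near_refl [simp]: "near w w"
  by (simp add: near_def)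

lemma not_nearD: "\<not> near w x \<Longrightarrow> x \<noteq> w \<and> \<not> adj w x \<and> \<not> adj x w"
  by (auto simp: near_def adj_sym)

lemma hop_sym: "hop w x y \<Longrightarrow> hop w y x"
  by (auto simp: hop_def adj_sym)

lemma joined_refl: "\<not> near w x \<Longrightarrow> joined w x x"
  by (simp add: joined_def)

lemma joined_not_near:
  assumes "joined w x y"
  shows "\<not> near w x" "\<not> near w y"
proof -
  show x: "\<not> near w x"
    using assms by (simp add: joined_def)
  have "(hop w)\<^sup>*\<^sup>* x y"
    using assms by (simp add: joined_def)
  then show "\<not> near w y"
    using x by (induction rule: rtranclp_induct) (auto simp: hop_def)
qed

lemma joined_sym: "joined w x y \<Longrightarrow> joined w y x"
proof -
  assume xy: "joined w x y"
  have "(hop w)\<^sup>*\<^sup>* x y"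
    using xy by (simp add: joined_def)
  then have "(hop w)\<^sup>*\<^sup>* y x"
    by (induction rule: rtranclp_induct) (auto intro: converse_rtranclp_into_rtranclp hop_sym)
  then show "joined w y x"
    using joined_not_near[OF xy] by (simp add: joined_def)
qed

lemma joined_trans: "joined w x y \<Longrightarrow> joined w y z \<Longrightarrow> joined w x z"
  by (auto simp: joined_def)

lemma joined_edge: "joined w x y \<Longrightarrow> adj y y' \<Longrightarrow> \<not> near w y' \<Longrightarrow> joined w x y'"
  using joined_not_near(2)[of w x y]
  by (auto simp: joined_def hop_def intro: rtranclp.rtrancl_into_rtrancl)

lemma joined_induct [consumes 1, case_names refl edge]:
  assumes "joined w x y" "P x"
    and "\<And>c c'. joined w x c \<Longrightarrow> joined w x c' \<Longrightarrow> adj c c' \<Longrightarrow> P c \<Longrightarrow> P c'"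
  shows "P y"
proof -
  have x: "\<not> near w x"
    using assms(1) by (simp add: joined_def)
  have "(hop w)\<^sup>*\<^sup>* x y"
    using assms(1) by (simp add: joined_def)
  then have "joined w x y \<and> P y"
  proof (induction rule: rtranclp_induct)
    case base
    show ?case using joined_refl[OF x] assms(2) by simp
  next
    case (step c c')
    then have "joined w x c'"
      by (auto simp: hop_def intro: joined_edge)
    then show ?case
      using step assms(3)[of c c'] by (auto simp: hop_def)
  qed
  then show ?thesis ..
qed

text \<open>
  A component of \<open>G - N[w]\<close> that meets no vertex of \<open>N[w']\<close> survives in \<open>G - N[w']\<close>; this is how
  one token's room to move is transferred from one parking position of the other token to another.
\<close>

lemma joined_transfer:
  assumes "joined w x y" and "\<And>c. joined w x c \<Longrightarrow> \<not> near w' c"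
  shows "joined w' x y"
  using assms(1)
proof (induction rule: joined_induct)
  case refl
  show ?case using assms joined_refl joined_not_near(1) by blast
next
  case (edge c c')
  then show ?case using joined_edge assms(2) by blast
qed

lemma block_subset_gate: "\<not> near u y \<Longrightarrow> block u y \<subseteq> gate u y"
  by (auto simp: block_def gate_def intro: joined_refl)

lemma gate_cong: "joined u y y' \<Longrightarrow> gate u y = gate u y'"
  by (auto simp: gate_def) (meson joined_sym joined_trans)+

lemma gate_adj: "p \<in> gate u y \<Longrightarrow> adj u p"
  by (simp add: gate_def)

lemma block_adj: "p \<in> block u y \<Longrightarrow> adj u p"
  by (simp add: block_def)

lemma not_block_iff: "adj u p \<Longrightarrow> p \<notin> block u y \<longleftrightarrow> \<not> adj p y"
  by (simp add: block_def)

lemma joined_neighbour: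
  assumes "joined z x u" "adj u p" "\<not> adj p z"
  shows "joined z x p"
proof -
  have "\<not> near z p"
    using assms joined_not_near(2)[OF assms(1)] by (auto simp: near_def adj_sym)
  then show ?thesis using joined_edge assms by blast
qed

lemma joined_back:
  assumes "joined z x p" "adj u p" "\<not> near z u"
  shows "joined z x u"
  using assms joined_edge adj_sym by blast

lemma joined_through_gate:
  assumes p: "joined z x p" "p \<in> gate u y"
    and far: "\<And>c. joined u y c \<Longrightarrow> \<not> near z c"
  shows "joined z x y"
proof -
  obtain y' where y': "joined u y y'" "adj p y'"
    using p(2) by (auto simp: gate_def)
  have "joined z x y'"
    using joined_edge[OF p(1) y'(2)] far y'(1) by blast
  moreover have "joined z y y'"
    using joined_transfer[OF y'(1) far] .
  ultimately show ?thesis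
    using joined_sym joined_trans by blast
qed

lemma other_component_far:
  assumes "\<not> near u z" "\<not> joined u z y" "joined u y c"
  shows "\<not> near z c"
proof
  assume "near z c"
  then have "joined u y z"
    using assms joined_edge adj_sym by (auto simp: near_def)
  then show False
    using assms(2) joined_sym by blast
qed

text \<open>
  While a token is parked at \<open>z\<close>, a token that can get to \<open>u\<close> can also enter any other component of
  \<open>G - N[u]\<close>, unless the parked token blocks all gates of that component.
\<close>

lemma enter_component:
  assumes u: "joined z x u" and y: "\<not> near u y" "\<not> joined u z y"
    and p: "p \<in> gate u y" "p \<notin> block u z"
  shows "joined z x y"
proof -
  have uz: "\<not> near u z"
    using joined_not_near(2)[OF u] near_commute by blast
  have "joined z x p"
    using joined_neighbour[OF u gate_adj[OF p(1)]] p gate_adj not_block_iff by blast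
  then show ?thesis
    using joined_through_gate p(1) other_component_far[OF uz y(2)] by blast
qed

end

section \<open>Walks without shortcuts\<close>

text \<open>
  In phase \<open>i \<in> {1..m}\<close> of a walk one token is parked at \<open>z i\<close> while the other one moves from
  \<open>z (i - 1)\<close> to \<open>z (i + 1)\<close> inside one component of \<open>G - N[z i]\<close>. The two last assumptions say that
  no walk with fewer phases arises from jumping directly from phase \<open>i\<close> to phase \<open>j\<close>, or from
  replacing everything in between by a single phase with a token parked at \<open>x\<close>.
\<close>

locale tight_walk = simple_graph adj
  for adj :: "'a \<Rightarrow> 'a \<Rightarrow> bool" +
  fixes z :: "nat \<Rightarrow> 'a" and m :: nat
  assumes walk: "1 \<le> i \<Longrightarrow> i \<le> m \<Longrightarrow> joined (z i) (z (i - 1)) (z (i + 1))"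
    and no_jump: "1 \<le> i \<Longrightarrow> i < j \<Longrightarrow> j \<le> m \<Longrightarrow> joined (z i) (z (i - 1)) (z j) \<Longrightarrow>
      joined (z j) (z i) (z (j + 1)) \<Longrightarrow> j \<le> i + 1"
    and no_bridge: "1 \<le> i \<Longrightarrow> i < j \<Longrightarrow> j \<le> m \<Longrightarrow> joined (z i) (z (i - 1)) x \<Longrightarrow>
      joined x (z i) (z j) \<Longrightarrow> joined (z j) x (z (j + 1)) \<Longrightarrow> j \<le> i + 2"
begin

text \<open>
  The component in which the token moving in phase \<open>i\<close> is confined.
\<close>

definition room :: "nat \<Rightarrow> 'a \<Rightarrow> bool" where
  "room i y \<longleftrightarrow> joined (z i) (z (i + 1)) y"

lemma room_next: "1 \<le> i \<Longrightarrow> i \<le> m \<Longrightarrow> room i (z (i + 1))"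
  using joined_refl joined_not_near(2) walk unfolding room_def by blast

lemma room_prev: "1 \<le> i \<Longrightarrow> i \<le> m \<Longrightarrow> room i (z (i - 1))"
  using joined_sym walk unfolding room_def by blast

lemma room_not_near: "room i y \<Longrightarrow> \<not> near (z i) y"
  unfolding room_def by (rule joined_not_near)

lemma room_joined: "room i x \<Longrightarrow> joined (z i) x y \<Longrightarrow> room i y"
  unfolding room_def by (rule joined_trans)

lemma rooms_joined: "room i x \<Longrightarrow> room i y \<Longrightarrow> joined (z i) x y"
  unfolding room_def using joined_sym joined_trans by blast

lemma room_edge: "room i x \<Longrightarrow> adj x y \<Longrightarrow> \<not> near (z i) y \<Longrightarrow> room i y"
  unfolding room_def by (rule joined_edge)

text \<open>
  Stated for rooms, the two minimality assumptions are symmetric in time.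
\<close>

lemma jump_bound:
  assumes "1 \<le> i" "i < j" "j \<le> m" "room i (z j)" "room j (z i)"
  shows "j \<le> i + 1"
proof (rule no_jump[OF assms(1-3)])
  show "joined (z i) (z (i - 1)) (z j)"
    using rooms_joined[OF room_prev assms(4)] assms by simp
  show "joined (z j) (z i) (z (j + 1))"
    using rooms_joined[OF assms(5) room_next] assms by simp
qed

lemma bridge_bound:
  assumes "1 \<le> i" "i < j" "j \<le> m" "room i x" "room j x" "joined x (z i) (z j)"
  shows "j \<le> i + 2"
proof (rule no_bridge[OF assms(1-3) _ assms(6)])
  show "joined (z i) (z (i - 1)) x"
    using rooms_joined[OF room_prev assms(4)] assms by simp
  show "joined (z j) x (z (j + 1))"
    using rooms_joined[OF assms(5) room_next] assms by simp
qed

text \<open>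
  If a set \<open>R\<close> can be left only through \<open>S\<close>, then in a phase that parks a token outside \<open>R\<close> and
  gives the other token no access to \<open>S\<close>, the moving token cannot enter or leave \<open>R\<close>. A phase that
  parks a token inside \<open>R\<close> keeps \<open>R\<close> occupied. So \<open>R\<close> becomes occupied or vacated only in phases of
  the following kind.
\<close>

definition crossing :: "'a set \<Rightarrow> 'a set \<Rightarrow> nat \<Rightarrow> 'a \<Rightarrow> bool" where
  "crossing R S i q \<longleftrightarrow> z i \<notin> R \<and> q \<in> S \<and> room i q"

lemma crossing_exists:
  assumes S: "S \<subseteq> R" and R: "\<And>y y'. y \<in> R \<Longrightarrow> y \<notin> S \<Longrightarrow> adj y y' \<Longrightarrow> y' \<in> R"
    and ij: "1 \<le> i" "i \<le> j" "j \<le> m" and y: "room i y" "room j y'"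
    and status: "(z i \<in> R \<or> y \<in> R) \<noteq> (z j \<in> R \<or> y' \<in> R)"
  shows "\<exists>k q. i \<le> k \<and> k \<le> j \<and> crossing R S k q"
proof (rule ccontr)
  assume "\<not> ?thesis"
  then have none: "\<not> crossing R S k q" if "i \<le> k" "k \<le> j" for k q
    using that by blast
  have mono: "d \<in> R" if k: "i \<le> k" "k \<le> j" "z k \<notin> R" and c: "room k c" "room k d" "c \<in> R" for k c d
    using rooms_joined[OF c(1,2)]
  proof (induction rule: joined_induct)
    case refl
    show ?case by (rule c(3))
  next
    case (edge e e')
    have "room k e" using room_joined c(1) edge by blast
    then have "e \<notin> S" using none k by (auto simp: crossing_def)
    then show ?case using R edge by blast
  qed
  have phase: "(z k \<in> R \<or> c \<in> R) = (z k \<in> R \<or> d \<in> R)"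
    if "i \<le> k" "k \<le> j" "room k c" "room k d" for k c d
    using mono that by blast
  have "k \<le> j \<Longrightarrow> \<forall>c. room k c \<longrightarrow> (z i \<in> R \<or> y \<in> R) = (z k \<in> R \<or> c \<in> R)"
    if "i \<le> k" for k
    using that
  proof (induction k rule: dec_induct)
    case base
    then show ?case using phase[OF _ _ y(1)] by blast
  next
    case (step k)
    have k: "1 \<le> k" "k \<le> m" "1 \<le> Suc k" "Suc k \<le> m"
      using step ij by auto
    have "(z i \<in> R \<or> y \<in> R) = (z k \<in> R \<or> z (Suc k) \<in> R)"
      using step room_next[OF k(1,2)] by auto
    moreover have "room (Suc k) (z k)"
      using room_prev[OF k(3,4)] by simp
    ultimately show ?case
      using phase[of "Suc k" "z k"] step by (metis le_SucI)
  qed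
  then show False
    using status ij y(2) by blast
qed

end

locale observed_walk = tight_walk adj z m
  for adj :: "'a \<Rightarrow> 'a \<Rightarrow> bool" and z m +
  fixes u :: 'a
begin

text \<open>
  Having access to \<open>u\<close> is the notion that the shortcut arguments can handle; whether the moving token
  really visits \<open>u\<close> depends on the path chosen inside its room.
\<close>

definition meets :: "nat \<Rightarrow> bool" where
  "meets i \<longleftrightarrow> 1 \<le> i \<and> i \<le> m \<and> room i u"

abbreviation same :: "nat \<Rightarrow> nat \<Rightarrow> bool" where
  "same i j \<equiv> joined u (z i) (z j)"

abbreviation gates :: "nat \<Rightarrow> 'a set" where
  "gates i \<equiv> gate u (z i)"

abbreviation blocked :: "nat \<Rightarrow> 'a set" where
  "blocked i \<equiv> block u (z i)"

lemma meets_range: "meets i \<Longrightarrow> 1 \<le> i \<and> i \<le> m"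
  by (simp add: meets_def)

lemma meets_room: "meets i \<Longrightarrow> room i u"
  by (simp add: meets_def)

lemma meets_not_near: "meets i \<Longrightarrow> \<not> near u (z i)"
  using room_not_near near_commute unfolding meets_def by blast

lemma meets_same_refl: "meets i \<Longrightarrow> same i i"
  by (simp add: joined_refl meets_not_near)

lemma meets_gates: "meets i \<Longrightarrow> blocked i \<subseteq> gates i"
  by (simp add: block_subset_gate meets_not_near)

lemma meetsI:
  assumes "1 \<le> i" "i \<le> m" "room i p" "adj u p" "\<not> near u (z i)"
  shows "meets i"
  using assms joined_back near_commute unfolding meets_def room_def by blast

lemma meets_room_neighbour:
  "meets i \<Longrightarrow> adj u p \<Longrightarrow> \<not> adj p (z i) \<Longrightarrow> room i p"
  unfolding meets_def room_def by (blast intro: joined_neighbour)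

lemma meets_room_gate:
  "meets i \<Longrightarrow> \<not> near u y \<Longrightarrow> \<not> joined u (z i) y \<Longrightarrow> \<not> gate u y \<subseteq> blocked i \<Longrightarrow> room i y"
  unfolding meets_def room_def by (blast intro: enter_component)

text \<open>
  Phases that meet \<open>u\<close> with their parked tokens in the same component of \<open>G - N[u]\<close> are bridged by a
  phase that parks a token at \<open>u\<close>.
\<close>

lemma same_close: "meets i \<Longrightarrow> meets j \<Longrightarrow> i < j \<Longrightarrow> same i j \<Longrightarrow> j \<le> i + 2"
  using bridge_bound unfolding meets_def by blast

text \<open>
  If neither parked token blocks all gates of the other one's component, both tokens can sit at
  \<open>z i\<close> and \<open>z j\<close> at the same time, and jumping from phase \<open>i\<close> to phase \<open>j\<close> is possible. So phases
  far apart are comparable, in the way intervals of the form from \<open>blocked\<close> to \<open>gates\<close> are.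
\<close>

lemma comparable:
  assumes "meets i" "meets j" "\<not> same i j" "i + 2 \<le> j \<or> j + 2 \<le> i"
  shows "gates i \<subseteq> blocked j \<or> gates j \<subseteq> blocked i"
proof (rule ccontr)
  assume neg: "\<not> ?thesis"
  have "\<not> same j i"
    using assms(3) joined_sym by blast
  then have "room j (z i)"
    using meets_room_gate[OF assms(2) meets_not_near[OF assms(1)]] neg by blast
  moreover have "room i (z j)"
    using meets_room_gate[OF assms(1) meets_not_near[OF assms(2)]] neg assms(3) by blast
  ultimately have "i < j \<longrightarrow> j \<le> i + 1" "j < i \<longrightarrow> i \<le> j + 1"
    using jump_bound[of i j] jump_bound[of j i] assms(1,2) meets_range by blast+
  then show False using assms(4) by linarith
qed

text \<open>
  Everything that lies below the interval of phase \<open>b\<close>, respectively everything that does not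
  exceed it. The component of \<open>z b\<close> is no part of \<open>low b\<close>, even if its gates are all blocked, so that
  tokens at \<open>u\<close> and \<open>z b\<close> always leave \<open>low b\<close> vacant; and it is part of \<open>high b\<close>.
\<close>

definition low :: "nat \<Rightarrow> 'a set" where
  "low b = blocked b \<union> {y. \<not> near u y \<and> gate u y \<subseteq> blocked b \<and> \<not> joined u (z b) y}"

definition high :: "nat \<Rightarrow> 'a set" where
  "high b = gates b \<union> {y. \<not> near u y \<and> gate u y \<subseteq> gates b}"

text \<open>
  A component of \<open>G - N[u]\<close> is adjacent to its gates only. So a union of components can be left only
  through a set that contains the gates of all of them.
\<close>

lemma region_boundary:
  assumes y: "y \<in> S \<union> {y. \<not> near u y \<and> gate u y \<subseteq> S \<and> Q y}" "y \<notin> S" and "adj y y'"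
    and Q: "\<And>c d. joined u c d \<Longrightarrow> Q c \<Longrightarrow> Q d"
  shows "y' \<in> S \<union> {y. \<not> near u y \<and> gate u y \<subseteq> S \<and> Q y}"
proof (cases "near u y'")
  case True
  then have "adj u y'"
    using y assms(3) by (auto simp: near_def adj_sym)
  moreover have "joined u y y" "adj y' y"
    using y assms(3) joined_refl adj_sym by (auto simp: near_def)
  ultimately have "y' \<in> gate u y"
    by (auto simp: gate_def)
  then show ?thesis using y by blast
next
  case False
  then have j: "joined u y y'"
    using y assms(3) joined_edge joined_refl by blast
  then show ?thesis
    using gate_cong[OF j] Q[OF j] y False by auto
qed

lemma low_boundary: "y \<in> low b \<Longrightarrow> y \<notin> blocked b \<Longrightarrow> adj y y' \<Longrightarrow> y' \<in> low b"
  unfolding low_def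
  by (rule region_boundary[where Q = "\<lambda>y. \<not> joined u (z b) y"])
    (use joined_sym joined_trans in blast)+

lemma high_boundary: "y \<in> high b \<Longrightarrow> y \<notin> gates b \<Longrightarrow> adj y y' \<Longrightarrow> y' \<in> high b"
  unfolding high_def
  using region_boundary[of y "gates b" "\<lambda>_. True" y'] by simp

lemma u_not_low: "u \<notin> low b"
  by (auto simp: low_def block_def adj_irrefl)

lemma u_not_high: "u \<notin> high b"
  by (auto simp: high_def gate_def adj_irrefl)

lemma low_iff:
  "\<not> near u y \<Longrightarrow> y \<in> low b \<longleftrightarrow> gate u y \<subseteq> blocked b \<and> \<not> joined u (z b) y"
  by (auto simp: low_def block_def near_def)

lemma high_iff: "\<not> near u y \<Longrightarrow> y \<in> high b \<longleftrightarrow> gate u y \<subseteq> gates b"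
  by (auto simp: high_def gate_def near_def)

lemma low_crossing_exists:
  assumes "1 \<le> i" "i \<le> j" "j \<le> m" "room i y" "room j y'"
    and "(z i \<in> low b \<or> y \<in> low b) \<noteq> (z j \<in> low b \<or> y' \<in> low b)"
  obtains k q where "i \<le> k" "k \<le> j" "crossing (low b) (blocked b) k q"
  using crossing_exists[of "blocked b" "low b" i j y y'] low_boundary assms
  by (auto simp: low_def)

lemma high_crossing_exists:
  assumes "1 \<le> i" "i \<le> j" "j \<le> m" "room i y" "room j y'"
    and "(z i \<in> high b \<or> y \<in> high b) \<noteq> (z j \<in> high b \<or> y' \<in> high b)"
  obtains k q where "i \<le> k" "k \<le> j" "crossing (high b) (gates b) k q"
  using crossing_exists[of "gates b" "high b" i j y y'] high_boundary assms
  by (auto simp: high_def)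

lemma jump_bound_sym:
  assumes "1 \<le> i" "i \<le> m" "1 \<le> j" "j \<le> m" "room i (z j)" "room j (z i)"
  shows "j \<le> i + 1 \<and> i \<le> j + 1"
  using jump_bound[of i j] jump_bound[of j i] assms by (cases i j rule: linorder_cases) auto

text \<open>
  At a crossing of \<open>low b\<close> the parked token does not hinder the moving one, which has access to a
  neighbour of \<open>z b\<close>, from going to \<open>z b\<close> or to \<open>u\<close>.
\<close>

lemma low_crossing_close:
  assumes b: "meets b" and i: "1 \<le> i" "i \<le> m" and cr: "crossing (low b) (blocked b) i q"
  shows "i \<le> b + 1 \<and> b \<le> i + 1 \<or>
    meets i \<and> same i b \<and> i \<le> b + 2 \<and> b \<le> i + 2"
proof -
  have q: "adj u q" "adj q (z b)" "room i q" and x: "z i \<notin> low b"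
    using cr by (auto simp: crossing_def block_def)
  have iq: "\<not> adj q (z i)" "z i \<noteq> q"
    using room_not_near[OF q(3)] by (auto simp: near_def adj_sym)
  then have iu: "z i \<noteq> u"
    using q(1) adj_sym by blast
  show ?thesis
  proof (cases "near u (z i)")
    case True
    then have ui: "adj u (z i)" using iu by (simp add: near_def)
    then have ib: "\<not> adj (z i) (z b)"
      using x by (auto simp: low_def block_def)
    have "room b (z i)"
      using meets_room_neighbour[OF b ui ib] .
    moreover have "\<not> near (z i) (z b)"
      using ib ui meets_not_near[OF b] by (auto simp: near_def)
    then have "room i (z b)"
      using room_edge q by blast
    ultimately show ?thesis
      using jump_bound_sym[OF i] meets_range[OF b] by simp
  next
    case far: False
    then have mi: "meets i"
      using meetsI i q by blast
    show ?thesis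
    proof (cases "same b i")
      case True
      then have "same i b" using joined_sym by blast
      then have "i \<le> b + 2 \<and> b \<le> i + 2"
        using same_close[of i b] same_close[of b i] mi b True by (cases i b rule: linorder_cases) auto
      then show ?thesis using mi \<open>same i b\<close> by blast
    next
      case False
      then have "room b (z i)"
        using meets_room_gate[OF b far] x by (auto simp: low_def far)
      moreover have "\<not> near (z i) (z b)"
        using other_component_far[of u "z i" "z b" "z b"] False far joined_sym
          joined_refl meets_not_near[OF b] by blast
      then have "room i (z b)"
        using room_edge q by blast
      ultimately show ?thesis
        using jump_bound_sym[OF i] meets_range[OF b] by simp
    qed
  qed
qed

text \<open>
  For \<open>high b\<close> there is no exception for a token parked in the component of \<open>z b\<close>, because such a
  token occupies \<open>high b\<close>.
\<close>

lemma high_crossing_close: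
  assumes b: "meets b" and i: "1 \<le> i" "i \<le> m" and cr: "crossing (high b) (gates b) i q"
  shows "i \<le> b + 1 \<and> b \<le> i + 1"
proof -
  have q: "q \<in> gates b" "room i q" and x: "z i \<notin> high b"
    using cr by (auto simp: crossing_def)
  have uq: "adj u q" using gate_adj q(1) .
  have iq: "\<not> adj q (z i)" "z i \<noteq> q"
    using room_not_near[OF q(2)] by (auto simp: near_def adj_sym)
  then have iu: "z i \<noteq> u"
    using uq adj_sym by blast
  have "room b (z i) \<and> room i (z b)"
  proof (cases "near u (z i)")
    case True
    then have ui: "adj u (z i)" using iu by (simp add: near_def)
    have ng: "z i \<notin> gates b"
      using x by (auto simp: high_def)
    then have "\<not> adj (z i) (z b)"
      using meets_gates[OF b] ui by (auto simp: block_def)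
    then have "room b (z i)"
      by (rule meets_room_neighbour[OF b ui])
    moreover have "\<not> near (z i) c" if "joined u (z b) c" for c
      using ng that ui joined_not_near(2)[OF that] by (auto simp: gate_def near_def)
    then have "room i (z b)"
      using joined_through_gate q unfolding room_def by blast
    ultimately show ?thesis ..
  next
    case far: False
    then have mi: "meets i"
      using meetsI i q(2) uq by blast
    have ng: "\<not> gates i \<subseteq> gates b"
      using x far by (simp add: high_iff)
    then have ns: "\<not> same b i"
      using gate_cong by blast
    then have "room b (z i)"
      using meets_room_gate[OF b far] ng meets_gates[OF b] by blast
    moreover have "room i (z b)"
      using meets_room_gate[OF mi meets_not_near[OF b]] ns q(1) iq uq joined_sym
      by (meson not_block_iff subsetD)
    ultimately show ?thesis ..
  qed
  then show ?thesis
    using jump_bound_sym[OF i] meets_range[OF b] by simp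
qed

end

section \<open>No visit between two distant phases\<close>

context observed_walk
begin

text \<open>
  The path of the moving token in phase \<open>k\<close> goes through \<open>v\<close>, \<open>u\<close>, \<open>w\<close> in this order and has no
  chords: before \<open>v\<close> it stays within one component of \<open>G - N[u]\<close>, and likewise after \<open>w\<close>.
\<close>

definition passes :: "nat \<Rightarrow> 'a \<Rightarrow> 'a \<Rightarrow> bool" where
  "passes k v w \<longleftrightarrow> v \<noteq> w \<and> adj u v \<and> adj u w \<and> \<not> adj v w \<and> \<not> adj v (z k) \<and> \<not> adj w (z k) \<and>
    (z (k - 1) = v \<or> \<not> near u (z (k - 1)) \<and> v \<in> gates (k - 1) \<and> \<not> adj w (z (k - 1))) \<and>
    (z (k + 1) = w \<or> \<not> near u (z (k + 1)) \<and> w \<in> gates (k + 1) \<and> \<not> adj v (z (k + 1)))"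

lemma crossing_meets_or_adj:
  assumes "1 \<le> i" "i \<le> m" "room i q" "adj u q"
  shows "meets i \<or> adj u (z i)"
  using assms meetsI[OF assms] room_not_near[OF assms(3)] adj_sym by (auto simp: near_def)

text \<open>
  If the gates of \<open>z i\<close> are just the vertices blocked by \<open>z j\<close>, a crossing of \<open>low j\<close> is a crossing
  of \<open>high i\<close> as well, with the only exception of a token parked in the component of \<open>z j\<close>.
\<close>

lemma tie_crossing:
  assumes "meets i" "meets j" "gates i = blocked j" "1 \<le> k" "k \<le> m"
    and cr: "crossing (low j) (blocked j) k q"
  shows "k \<le> i + 1 \<and> i \<le> k + 1 \<or> meets k \<and> same j k \<and> q \<in> gates i \<and> q \<notin> blocked k"
proof (cases "z k \<in> high i")
  case False
  then have "crossing (high i) (gates i) k q"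
    using cr assms(3) by (auto simp: crossing_def)
  then show ?thesis using high_crossing_close assms by blast
next
  case True
  have q: "q \<in> blocked j" "room k q" and x: "z k \<notin> low j"
    using cr by (auto simp: crossing_def)
  have far: "\<not> near u (z k)"
    using True x assms(3) by (auto simp: high_def low_def)
  then have "meets k"
    using meetsI assms(4,5) q block_adj by blast
  moreover have "gates k \<subseteq> blocked j"
    using True far assms(3) by (simp add: high_iff)
  then have "same j k"
    using x far by (auto simp: low_iff)
  moreover have "q \<notin> blocked k"
    using room_not_near[OF q(2)] by (auto simp: block_def near_def adj_sym)
  ultimately show ?thesis using q assms(3) by blast
qed

text \<open>
  If each of \<open>z l\<close>, \<open>z j\<close> blocks all gates of the other one, the two components have the same gates.
  To get from one to the other the tokens have to leave \<open>low j\<close> shortly before phase \<open>j\<close>, with the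
  other token in the component of \<open>z j\<close>, and they enter \<open>low l\<close> shortly after phase \<open>l\<close>, with the other
  token in the component of \<open>z l\<close>. These two moments are comparable only if they are close.
\<close>

lemma not_mutually_blocked:
  assumes l: "meets l" and j: "meets j" and lj: "l + 6 \<le> j" "\<not> same l j"
    and tie: "gates l \<subseteq> blocked j" "gates j \<subseteq> blocked l"
  shows False
proof -
  have eq: "gates l = blocked l" "gates j = blocked j" "blocked l = blocked j"
    using tie meets_gates l j by blast+
  have nl: "\<not> near u (z l)" and nj: "\<not> near u (z j)"
    using meets_not_near l j by auto
  have jl: "\<not> same j l" using lj(2) joined_sym by blast
  have r: "room l u" "room j u" "1 \<le> l" "l \<le> j" "j \<le> m"
    using l j lj by (auto simp: meets_def)
  have "z l \<in> low j" "z j \<notin> low j" "z j \<in> low l" "z l \<notin> low l"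
    using tie eq nl nj lj(2) jl meets_same_refl l j by (auto simp: low_iff)
  then obtain k q k' q' where k: "l \<le> k" "k \<le> j" "crossing (low j) (blocked j) k q"
    and k': "l \<le> k'" "k' \<le> j" "crossing (low l) (blocked l) k' q'"
    using low_crossing_exists[OF r(3-5,1,2), of j] low_crossing_exists[OF r(3-5,1,2), of l] u_not_low
    by metis
  have km: "1 \<le> k" "k \<le> m" "1 \<le> k'" "k' \<le> m"
    using k k' r by auto
  have K: "meets k" "same j k" "q \<in> gates l" "q \<notin> blocked k"
    using tie_crossing[OF l j _ km(1,2) k(3)] tie_crossing[OF j j _ km(1,2) k(3)] eq lj by auto
  have K': "meets k'" "same l k'" "q' \<in> gates l" "q' \<notin> blocked k'"
    using tie_crossing[OF l l _ km(3,4) k'(3)] tie_crossing[OF j l _ km(3,4) k'(3)] eq lj by auto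
  have "j \<le> k + 2" "k' \<le> l + 2"
    using low_crossing_close[OF j km(1,2) k(3)] low_crossing_close[OF l km(3,4) k'(3)] by auto
  moreover have "\<not> same k' k"
    using K(2) K'(2) lj(2) joined_sym joined_trans by blast
  ultimately have "gates k \<subseteq> blocked k' \<or> gates k' \<subseteq> blocked k"
    using comparable[OF K'(1) K(1)] lj by auto
  then show False
    using K K' gate_cong[OF K(2)] gate_cong[OF K'(2)] eq by blast
qed

text \<open>
  If \<open>z j\<close> were in \<open>high i\<close>, the gates of \<open>z i\<close> and of \<open>z j\<close> would agree. Shortly before phase \<open>j\<close> a
  token would then be parked in the component of \<open>z j\<close> such that one of these gates is free; since
  \<open>z i\<close> leaves one of them free as well, the two phases contradict comparability.
\<close>

lemma escape_high:
  assumes i: "meets i" and j: "meets j" and ij: "i + 4 \<le> j" "\<not> same i j"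
    and sub: "gates i \<subseteq> blocked j" "\<not> blocked j \<subseteq> blocked i"
  shows "z j \<notin> high i"
proof
  assume "z j \<in> high i"
  then have "gates j \<subseteq> gates i"
    using meets_not_near[OF j] high_iff by blast
  then have eq: "gates i = blocked j" "gates j = blocked j"
    using sub meets_gates[OF j] by blast+
  have r: "room i u" "room j u" "1 \<le> i" "i \<le> j" "j \<le> m"
    using i j ij by (auto simp: meets_def)
  have "z i \<in> low j" "z j \<notin> low j"
    using sub ij(2) meets_same_refl[OF j] meets_not_near i j joined_sym by (auto simp: low_iff)
  then obtain k q where k: "i \<le> k" "k \<le> j" "crossing (low j) (blocked j) k q"
    using low_crossing_exists[OF r(3-5,1,2), of j] u_not_low by metis
  have km: "1 \<le> k" "k \<le> m"
    using k r by auto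
  have "j \<le> k + 2"
    using low_crossing_close[OF j km k(3)] by auto
  then have K: "meets k" "same j k" "q \<in> gates i" "q \<notin> blocked k"
    using tie_crossing[OF i j eq(1) km k(3)] ij by auto
  have "\<not> same i k"
    using K(2) ij(2) joined_sym joined_trans by blast
  then have "gates k \<subseteq> blocked i \<or> gates i \<subseteq> blocked k"
    using comparable[OF i K(1)] \<open>j \<le> k + 2\<close> ij by auto
  then show False
    using K gate_cong[OF K(2)] eq sub by auto
qed

text \<open>
  When the component of \<open>z i\<close> lies below \<open>z j\<close>, the tokens abandon \<open>high i\<close> for good right after
  phase \<open>i\<close>: they have to leave it before phase \<open>j\<close>, and every crossing is close to \<open>i\<close>.
\<close>

lemma high_abandoned:
  assumes i: "meets i" and j: "meets j" and ij: "i + 4 \<le> j" "\<not> same i j"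
    and sub: "gates i \<subseteq> blocked j" "\<not> blocked j \<subseteq> blocked i"
    and h: "i < h" "h \<le> j"
  shows "z h \<notin> high i" "i + 2 \<le> h \<Longrightarrow> room h y \<Longrightarrow> y \<notin> high i"
proof -
  have crossing_next: "\<exists>q. h = i + 1 \<and> crossing (high i) (gates i) h q"
    if hit: "z h \<in> high i \<or> y \<in> high i" "room h y" for y
  proof -
    have r: "1 \<le> h" "j \<le> m" "room j u"
      using h i j by (auto simp: meets_def)
    have "(z h \<in> high i \<or> y \<in> high i) \<noteq> (z j \<in> high i \<or> u \<in> high i)"
      using hit(1) escape_high[OF i j ij sub] u_not_high by blast
    then obtain k q where k: "h \<le> k" "k \<le> j" "crossing (high i) (gates i) k q"
      using high_crossing_exists[OF r(1) h(2) r(2) hit(2) r(3)] by blast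
    then have "k \<le> i + 1"
      using high_crossing_close[OF i _ _ k(3)] h r by auto
    then have "k = h" "h = i + 1"
      using k h by auto
    then show ?thesis using k by blast
  qed
  have "1 \<le> h" "h \<le> m"
    using h i j by (auto simp: meets_def)
  then show "z h \<notin> high i"
    using crossing_next[OF _ room_next] by (auto simp: crossing_def)
  show "i + 2 \<le> h \<Longrightarrow> room h y \<Longrightarrow> y \<notin> high i"
    using crossing_next[of y] by auto
qed

end

text \<open>
  Three phases that meet \<open>u\<close>, in an order in which the parked tokens climb: the gates of each
  component are blocked by the next parked token.
\<close>

locale ascent = observed_walk adj z m u
  for adj :: "'a \<Rightarrow> 'a \<Rightarrow> bool" and z m u +
  fixes l k j :: nat
  assumes meets_lkj: "meets l" "meets k" "meets j"
    and gaps: "l + 3 \<le> k" "k + 3 \<le> j"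
    and climb: "gates l \<subseteq> blocked k" "gates k \<subseteq> blocked j"
begin

lemma lkj_range: "1 \<le> l" "l + 3 \<le> k" "k + 3 \<le> j" "j \<le> m"
  using meets_lkj gaps meets_range by auto

lemma not_same: "\<not> same l k" "\<not> same k j" "\<not> same l j"
  using same_close meets_lkj gaps by fastforce+

text \<open>
  In phase \<open>l\<close> the part below \<open>z k\<close> is occupied, in phase \<open>k\<close> it is vacant. It cannot be vacated while
  a token is parked in the component of \<open>z k\<close>, since the tokens would then have to abandon this
  component for good, although it contains \<open>z k\<close>. Any other crossing is next to phase \<open>k\<close>.
\<close>

lemma rise_before:
  obtains q where "crossing (low k) (blocked k) (k - 1) q" "q \<notin> blocked (k - 1)"
    "adj u (z (k - 1)) \<or>
     meets (k - 1) \<and> \<not> same (k - 1) k \<and> \<not> gates (k - 1) \<subseteq> blocked k"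
proof -
  have r: "1 \<le> l" "l \<le> k" "k \<le> m" "room l u" "room k u"
    using lkj_range meets_lkj meets_room by auto
  have "z l \<in> low k"
    using low_iff meets_not_near meets_lkj(1) climb(1) not_same(1) joined_sym by blast
  moreover have "z k \<notin> low k"
    using meets_same_refl meets_not_near meets_lkj by (auto simp: low_iff)
  ultimately have "(z l \<in> low k \<or> u \<in> low k) \<noteq> (z k \<in> low k \<or> u \<in> low k)"
    using u_not_low by blast
  then obtain i q where i: "l \<le> i" "i \<le> k" "crossing (low k) (blocked k) i q"
    using low_crossing_exists[OF r] by blast
  have q: "q \<in> blocked k" "room i q" "z i \<notin> low k"
    using i(3) by (auto simp: crossing_def)
  have qi: "q \<notin> blocked i"
    using room_not_near[OF q(2)] by (auto simp: block_def near_def adj_sym)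
  then have "i \<noteq> k"
    using q(1) by blast
  have im: "1 \<le> i" "i \<le> m"
    using i r by auto
  have sub: "blocked k \<subseteq> gates k"
    using meets_gates meets_lkj(2) .
  have not_same_k: "\<not> same i k" if mi: "meets i"
  proof
    assume s: "same i k"
    have "\<not> same i j"
      using s not_same(2) joined_sym joined_trans by blast
    moreover have "gates i \<subseteq> blocked j" "\<not> blocked j \<subseteq> blocked i"
      using gate_cong[OF s] climb(2) sub q(1) qi by blast+
    ultimately have "z k \<notin> high i"
      using high_abandoned(1)[OF mi meets_lkj(3)] i \<open>i \<noteq> k\<close> lkj_range by simp
    then show False
      using gate_cong[OF s] meets_not_near[OF meets_lkj(2)] by (simp add: high_iff)
  qed
  then have "i \<le> k + 1 \<and> k \<le> i + 1"
    using low_crossing_close[OF meets_lkj(2) im i(3)] by blast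
  then have ik: "i = k - 1"
    using i(2) \<open>i \<noteq> k\<close> by simp
  have "\<not> gates i \<subseteq> blocked k" if mi: "meets i"
    using low_iff[OF meets_not_near[OF mi]] q(3) not_same_k[OF mi] joined_sym[of u "z k" "z i"]
    by blast
  then have "adj u (z i) \<or> meets i \<and> \<not> same i k \<and> \<not> gates i \<subseteq> blocked k"
    using crossing_meets_or_adj[OF im q(2) block_adj[OF q(1)]] not_same_k by blast
  then show thesis
    using that[of q] i(3) qi unfolding ik by blast
qed

text \<open>
  Otherwise \<open>z k\<close> and \<open>z j\<close> would have the same gates and the crossing before phase \<open>k\<close> would be one
  close to phase \<open>j\<close>.
\<close>

lemma no_descent: "\<not> gates j \<subseteq> blocked k"
proof
  assume tie: "gates j \<subseteq> blocked k"
  have "gates j = blocked k"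
    using tie climb(2) meets_gates meets_lkj by blast
  moreover obtain q where q: "crossing (low k) (blocked k) (k - 1) q"
    "adj u (z (k - 1)) \<or> meets (k - 1) \<and> \<not> same (k - 1) k"
    using rise_before by metis
  ultimately have "meets (k - 1) \<and> same k (k - 1)"
    using tie_crossing[OF meets_lkj(3,2), of "k - 1" q] lkj_range by auto
  then show False
    using q(2) meets_not_near[of "k - 1"] joined_sym near_def by blast
qed

text \<open>
  Dually, \<open>high k\<close> is occupied in phase \<open>k\<close> and vacated at once, in phase \<open>k + 1\<close>. If \<open>z j\<close> itself is
  in \<open>high k\<close>, the set to be vacated is \<open>low j\<close>, and a crossing of it serves the same purpose. The
  index \<open>h\<close> is there to show that no token is parked in the component of \<open>z k\<close> later on.
\<close>

lemma rise_after:
  assumes h: "k \<le> h" "h \<le> j" and hk: "same k h"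
  shows "h = k" "\<exists>q. q \<in> gates k \<and> room (k + 1) q \<and>
    (meets (k + 1) \<or> adj u (z (k + 1)) \<and> z (k + 1) \<notin> gates k)"
proof -
  have r: "1 \<le> h" "j \<le> m" "h \<le> m" "room j u"
    using lkj_range h meets_lkj meets_room by auto
  have far: "\<not> near u (z h)" "\<not> near u (z j)"
    using joined_not_near(2)[OF hk] meets_not_near meets_lkj by auto
  have zh: "z h \<in> high k"
    using far gate_cong[OF hk] by (simp add: high_iff)
  have "h = k \<and> (\<exists>q. q \<in> gates k \<and> room (k + 1) q \<and>
    (meets (k + 1) \<or> adj u (z (k + 1)) \<and> z (k + 1) \<notin> gates k))"
  proof (cases "z j \<in> high k")
    case False
    then obtain i q where i: "h \<le> i" "i \<le> j" "crossing (high k) (gates k) i q"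
      using high_crossing_exists[OF r(1) h(2) r(2) room_next[OF r(1,3)] r(4)] zh u_not_high
      by metis
    have im: "1 \<le> i" "i \<le> m"
      using i r by auto
    have q: "q \<in> gates k" "room i q" "z i \<notin> high k"
      using i(3) by (auto simp: crossing_def)
    have "i \<noteq> h" using zh q(3) by blast
    then have "i = k + 1" "h = k"
      using high_crossing_close[OF meets_lkj(2) im i(3)] i(1) h(1) by auto
    then show ?thesis
      using crossing_meets_or_adj[OF im q(2) gate_adj[OF q(1)]] q by (auto simp: high_def)
  next
    case True
    then have eq: "gates k = blocked j" "gates j = gates k"
      using climb(2) meets_gates[OF meets_lkj(3)] far by (auto simp: high_iff)
    have "\<not> same j h"
      using hk not_same(2) joined_sym joined_trans by blast
    then have zh: "z h \<in> low j"
      using gate_cong[OF hk] climb(2) far by (auto simp: low_iff)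
    moreover have "z j \<notin> low j"
      using far joined_refl by (auto simp: low_iff)
    ultimately obtain i q where i: "h \<le> i" "i \<le> j" "crossing (low j) (blocked j) i q"
      using low_crossing_exists[OF r(1) h(2) r(2) room_next[OF r(1,3)] r(4)] u_not_low
      by metis
    have im: "1 \<le> i" "i \<le> m"
      using i r by auto
    have q: "q \<in> gates k" "room i q" "z i \<notin> low j"
      using i(3) eq by (auto simp: crossing_def)
    have "i \<noteq> h" using zh q(3) by blast
    have "j \<le> i + 2"
      using low_crossing_close[OF meets_lkj(3) im i(3)] by auto
    have "i \<le> k + 1"
      using tie_crossing[OF meets_lkj(2,3) eq(1) im i(3)]
    proof
      assume c: "meets i \<and> same j i \<and> q \<in> gates k \<and> q \<notin> blocked i"
      then have "\<not> same k i"
        using not_same(2) joined_sym joined_trans by blast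
      moreover have "\<not> gates k \<subseteq> blocked i" "\<not> gates i \<subseteq> blocked k"
        using c gate_cong[of u "z j" "z i"] no_descent by blast+
      ultimately have "\<not> k + 2 \<le> i"
        using comparable[OF meets_lkj(2), of i] c by blast
      then show "i \<le> k + 1" by simp
    qed simp
    then have "i = k + 1" "h = k"
      using \<open>j \<le> i + 2\<close> \<open>i \<noteq> h\<close> i(1) h(1) lkj_range by auto
    then show ?thesis
      using crossing_meets_or_adj[OF im q(2) gate_adj[OF q(1)]] q eq by (auto simp: low_def)
  qed
  then show "h = k" "\<exists>q. q \<in> gates k \<and> room (k + 1) q \<and>
    (meets (k + 1) \<or> adj u (z (k + 1)) \<and> z (k + 1) \<notin> gates k)"
    by auto
qed

lemma never_low_again:
  assumes h: "k + 2 \<le> h" "h \<le> j"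
  shows "z h \<notin> low k"
proof
  assume zh: "z h \<in> low k"
  have r: "1 \<le> h" "j \<le> m" "h \<le> m" "room j u"
    using lkj_range h meets_lkj meets_room by auto
  have "z j \<notin> low k"
    using no_descent meets_not_near meets_lkj by (auto simp: low_iff)
  then obtain i q where i: "h \<le> i" "i \<le> j" "crossing (low k) (blocked k) i q"
    using low_crossing_exists[OF r(1) h(2) r(2) room_next[OF r(1,3)] r(4)] zh u_not_low
    by metis
  have "i \<le> k + 2"
    using low_crossing_close[OF meets_lkj(2) _ _ i(3)] i r by auto
  then have "i = h"
    using i h by simp
  then show False
    using i(3) zh by (simp add: crossing_def)
qed

lemma later_meets:
  assumes "k + 2 \<le> h" "h \<le> j" "meets h"
  shows "gates k \<subseteq> blocked h"
proof -
  have ns: "\<not> same k h"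
    using rise_after(1)[of h] assms by auto
  then have "\<not> gates h \<subseteq> blocked k"
    using never_low_again[OF assms(1,2)] low_iff[OF meets_not_near[OF assms(3)]] by blast
  then show ?thesis
    using comparable[OF meets_lkj(2) assms(3) ns] assms(1) by blast
qed

text \<open>
  The moving token starts phase \<open>k\<close> in a component of \<open>G - N[u]\<close>. That component also lies below
  \<open>z j\<close>, so after phase \<open>k\<close> no token returns there. If the moving token comes to rest at \<open>w\<close>
  adjacent to \<open>u\<close>, the gate \<open>v\<close> remains out of reach for both tokens, and therefore \<open>u\<close> as well.
\<close>

lemma no_start_in_component:
  assumes vw: "passes k v w" and pre: "meets (k - 1)" "\<not> same (k - 1) k"
    "\<not> gates (k - 1) \<subseteq> blocked k" "q \<in> blocked k" "q \<notin> blocked (k - 1)"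
    and post: "meets (k + 1) \<or> adj u (z (k + 1))"
  shows False
proof -
  have r: "1 \<le> k - 1" "k - 1 + 4 \<le> j" "k - 1 < k + 1" "k + 1 \<le> j"
    using lkj_range by auto
  have qj: "q \<in> blocked j" "q \<in> gates j"
    using climb(2) meets_gates meets_lkj(2,3) pre(4) by blast+
  have nsj: "\<not> same (k - 1) j"
    using same_close[OF pre(1) meets_lkj(3)] r by fastforce
  then have "gates (k - 1) \<subseteq> blocked j"
    using comparable[OF pre(1) meets_lkj(3)] r qj pre(5) by auto
  note gone = high_abandoned[OF pre(1) meets_lkj(3) r(2) nsj this]
  have sub: "\<not> blocked j \<subseteq> blocked (k - 1)"
    using qj pre(5) by blast
  have not_meets: "\<not> meets (k + 1)"
  proof
    assume post: "meets (k + 1)"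
    show False
    proof (cases "same (k - 1) (k + 1)")
      case True
      then have "z (k + 1) \<in> high (k - 1)"
        using gate_cong[OF True] meets_not_near[OF post] by (simp add: high_iff)
      then show False using gone(1)[OF sub, of "k + 1"] r by simp
    next
      case False
      have "v \<in> gates (k - 1)" "w \<in> gates (k + 1)" "v \<notin> blocked (k + 1)" "w \<notin> blocked (k - 1)"
        using vw meets_not_near[OF pre(1)] meets_not_near[OF post]
        by (auto simp: passes_def near_def block_def)
      then show False
        using comparable[OF pre(1) post False] r by auto
    qed
  qed
  then have w: "z (k + 1) = w" "adj u w" "\<not> adj v w" "adj u v"
    using vw post by (auto simp: passes_def near_def)
  have v: "v \<in> gates (k - 1)"
    using vw meets_not_near[OF pre(1)] by (auto simp: passes_def near_def)
  then have v_high: "v \<in> high (k - 1)"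
    by (simp add: high_def)
  have "adj u (z h) \<and> \<not> adj v (z h)" if "k + 1 \<le> h" "h \<le> j" for h
    using that
  proof (induction h rule: dec_induct)
    case base
    then show ?case using w by simp
  next
    case (step h)
    have hm: "1 \<le> h" "h \<le> m" "1 \<le> Suc h" "Suc h \<le> m"
      using step lkj_range by auto
    have next_room: "room h (z (Suc h))" "room (Suc h) (z h)"
      using room_next[OF hm(1,2)] room_prev[OF hm(3,4)] by auto
    have kh: "k - 1 < h" "h \<le> j" "k - 1 + 2 \<le> h"
      "k - 1 < Suc h" "Suc h \<le> j" "k - 1 + 2 \<le> Suc h"
      using step r(1) by auto
    have out: "\<not> room h v" "\<not> room (Suc h) v"
      using gone(2)[OF sub kh(1-3)] gone(2)[OF sub kh(4-6)] v_high by blast+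
    have "z h \<noteq> v"
      using gone(1)[OF sub kh(1,2)] v_high by blast
    then have "\<not> near (z h) v"
      using step adj_sym[of "z h" v] by (auto simp: near_def)
    then have nv: "\<not> adj v (z (Suc h))"
      using room_edge[OF next_room(1), of v] out(1) adj_sym[of v "z (Suc h)"] by blast
    have "\<not> meets (Suc h)"
      using meets_room_neighbour[OF _ w(4) nv] out(2) by blast
    then have "adj u (z (Suc h))"
      using crossing_meets_or_adj[OF hm(3,4) next_room(2)] step by auto
    then show ?case using nv by blast
  qed
  then have "adj u (z j)"
    using r by blast
  then show False
    using meets_not_near[OF meets_lkj(3)] by (simp add: near_def)
qed

text \<open>
  The mirror image in time, which is easier as the order is not reversed: the part below
  \<open>z (k + 1)\<close> has to be vacated in phase \<open>k - 1\<close> already, two phases early, and this requires a token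
  parked in the component of \<open>z (k + 1)\<close> instead of at \<open>v\<close>.
\<close>

lemma no_stop_in_component:
  assumes v: "z (k - 1) = v" "adj u v" "\<not> adj v (z (k + 1))"
    and w: "w \<in> gates (k + 1)" "\<not> adj w (z k)" "adj u w"
    and pre: "q \<in> blocked k" and post: "meets (k + 1)" "q' \<in> gates k" "room (k + 1) q'"
  shows False
proof -
  have r: "1 \<le> l" "l \<le> k - 1" "k - 1 \<le> m" "1 \<le> k - 1" "l + 2 \<le> k + 1" "room l u"
    using lkj_range meets_lkj meets_room by auto
  have ns: "\<not> same l (k + 1)"
    using same_close[OF meets_lkj(1) post(1)] lkj_range by fastforce
  have "w \<notin> blocked k"
    using w(2) by (simp add: block_def)
  then have "\<not> gates (k + 1) \<subseteq> blocked l"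
    using w(1) climb(1) meets_gates[OF meets_lkj(1)] by blast
  then have "gates l \<subseteq> blocked (k + 1)"
    using comparable[OF meets_lkj(1) post(1) ns] r by blast
  then have "z l \<in> low (k + 1)"
    using low_iff meets_not_near meets_lkj(1) ns joined_sym by blast
  moreover have q': "q' \<notin> blocked (k + 1)"
    using room_not_near[OF post(3)] by (auto simp: block_def near_def adj_sym)
  then have "z k \<notin> low (k + 1)"
    using post(2) meets_not_near meets_lkj by (auto simp: low_iff)
  moreover have "z (k - 1) \<notin> low (k + 1)"
    using v by (auto simp: low_def block_def near_def)
  moreover have "room (k - 1) (z k)"
    using room_next[OF r(4,3)] r(4) by simp
  ultimately obtain i q where i: "l \<le> i" "i \<le> k - 1"
    "crossing (low (k + 1)) (blocked (k + 1)) i q"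
    using low_crossing_exists[OF r(1-3,6)] by metis
  have im: "1 \<le> i" "i \<le> m"
    using i r by auto
  have ik: "i = k - 1"
    using low_crossing_close[OF post(1) im i(3)] i by auto
  have "\<not> meets i"
    using ik v meets_not_near[of i] by (auto simp: near_def)
  then show False
    using low_crossing_close[OF post(1) im i(3)] i r by auto
qed

text \<open>
  Here the moving token only hops from \<open>v\<close> over \<open>u\<close> to \<open>w\<close>. Unless \<open>v\<close> is accessible in phase
  \<open>k + 1\<close>, the later positions that have contact with the component \<open>H\<close> of \<open>z k\<close> in \<open>G - N[v]\<close> all
  lie in \<open>H\<close>, and contact once lost is never regained; so \<open>u\<close> cannot be met again.
\<close>

lemma hop_forward:
  assumes v: "z (k - 1) = v" "adj u v" and w: "z (k + 1) = w" "adj u w" "\<not> adj v w" "w \<noteq> v"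
    and q: "q \<in> blocked k" "room (k - 1) q" and out: "\<not> room (k + 1) v"
  shows False
proof -
  have r: "1 \<le> k - 1" "k - 1 \<le> m" "1 \<le> k + 1" "k + 1 \<le> m" "k + 3 \<le> j" "j \<le> m" "1 \<le> k" "k \<le> m"
    using lkj_range by auto
  define H where "H = {y. room (k - 1) y}"
  define contact where "contact y \<longleftrightarrow> y \<in> H \<or> (\<exists>c\<in>H. adj y c)" for y
  have H_far: "\<not> near v y" if "y \<in> H" for y
    using that room_not_near v(1) by (auto simp: H_def)
  have zk: "z k \<in> H"
    using room_next[OF r(1,2)] r by (auto simp: H_def)
  have qH: "q \<in> H"
    using q by (simp add: H_def)
  have H_joined: "joined v c d" if "c \<in> H" "d \<in> H" for c d
    using rooms_joined that v(1) by (auto simp: H_def)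
  have H_edge: "y \<in> H" if "contact y" "\<not> near v y" for y
    using that room_edge v(1) adj_sym unfolding contact_def H_def by blast
  \<comment> \<open>a token parked in \<open>H\<close> leaves no way to \<open>v\<close>: this would be a jump from phase \<open>k - 1\<close>\<close>
  have no_v: "\<not> room h v" if "k + 1 \<le> h" "h \<le> m" "h = k + 1 \<or> z h \<in> H" for h
  proof
    assume hv: "room h v"
    then have "h \<noteq> k + 1" using out by blast
    then have "room (k - 1) (z h)" "k + 1 < h" using that by (auto simp: H_def)
    moreover have "k - 1 < h" using that(1) by simp
    ultimately show False
      using jump_bound[of "k - 1" h] r(1) that(2) hv v(1) by simp
  qed
  \<comment> \<open>a token parked without contact to \<open>H\<close> could be swapped with \<open>z k\<close> across \<open>H\<close>\<close>
  have no_H: "\<not> room h c" if "k + 2 \<le> h" "h \<le> m" "adj u (z h)" "\<not> contact (z h)" "c \<in> H" for h c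
  proof
    assume c: "room h c"
    have "\<not> near (z h) d" if "joined v c d" for d
      using that \<open>\<not> contact (z h)\<close> \<open>c \<in> H\<close> room_joined v(1)
      unfolding near_def contact_def H_def by blast
    then have "joined (z h) c (z k)"
      using joined_transfer H_joined[OF \<open>c \<in> H\<close> zk] by blast
    then have "room h (z k)"
      using room_joined c by blast
    moreover have "room k (z h)"
      using meets_room_neighbour[OF meets_lkj(2) that(3)] that(4) zk by (auto simp: contact_def)
    ultimately show False
      using jump_bound[of k h] r that by simp
  qed
  have "adj u (z h) \<and> (z h \<in> H \<or> \<not> contact (z h))" if "k + 2 \<le> h" "h \<le> j" for h
    using that
  proof (induction h rule: dec_induct)
    case base
    have k1: "room (k + 1) (z k)" "room (k + 1) (z (k + 2))" "room (k + 2) w"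
      using room_prev[OF r(3,4)] room_next[OF r(3,4)] room_prev[of "k + 2"] r w(1) by auto
    have "\<not> near v c" if c: "joined w (z k) c" for c
    proof
      assume "near v c"
      have "room (k + 1) c"
        using room_joined k1(1) c w(1) by blast
      moreover have "\<not> near w v"
        using w by (auto simp: near_def adj_sym)
      ultimately have "room (k + 1) v"
        using room_edge[of "k + 1" c v] w(1) \<open>near v c\<close> adj_sym by (auto simp: near_def)
      then show False using out by blast
    qed
    then have "joined v (z k) (z (k + 2))"
      using joined_transfer rooms_joined[OF k1(1,2)] w(1) by blast
    then have z2: "z (k + 2) \<in> H"
      using zk room_joined v(1) by (auto simp: H_def)
    have "\<not> meets (k + 2)"
      using meets_room_neighbour[of "k + 2" v] no_v[of "k + 2"] z2 v(2) H_far[OF z2] r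
      by (auto simp: near_def)
    then show ?case
      using crossing_meets_or_adj[of "k + 2" w] k1(3) w(2) z2 r by auto
  next
    case (step h)
    have hm: "1 \<le> h" "h \<le> m" "1 \<le> Suc h" "Suc h \<le> m" "k + 2 \<le> h" "k + 2 \<le> Suc h" "Suc h \<le> j"
      using step r by auto
    have IH: "adj u (z h)" "z h \<in> H \<or> \<not> contact (z h)"
      using step hm by auto
    have nr: "room h (z (Suc h))" "room (Suc h) (z h)"
      using room_next[OF hm(1,2)] room_prev[OF hm(3,4)] by auto
    have H_or: "z (Suc h) \<in> H \<or> \<not> contact (z (Suc h))"
    proof (cases "z h \<in> H")
      case True
      have nv: "\<not> room h v"
        using no_v[of h] True hm by simp
      have hv: "\<not> near (z h) v"
        using H_far[OF True] near_commute by blast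
      have "\<not> near v (z (Suc h))"
        using room_edge[OF nr(1) _ hv] nr(1) nv adj_sym unfolding near_def by metis
      then show ?thesis using H_edge by blast
    next
      case False
      then have nc: "\<not> contact (z h)" using IH by blast
      have noH: "\<not> room h c" if "c \<in> H" for c
        using no_H[OF hm(5,2) IH(1) nc that] .
      have "\<not> adj (z (Suc h)) c" if "c \<in> H" for c
        using room_edge[OF nr(1), of c] noH[OF that] nc that False
        by (auto simp: near_def contact_def)
      then show ?thesis using noH nr(1) by (auto simp: contact_def)
    qed
    have "\<not> meets (Suc h)"
    proof
      assume ms: "meets (Suc h)"
      from H_or show False
      proof
        assume zH: "z (Suc h) \<in> H"
        then show False
          using meets_room_neighbour[OF ms v(2)] no_v[of "Suc h"] H_far[OF zH] hm
          by (auto simp: near_def)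
      next
        assume nc: "\<not> contact (z (Suc h))"
        have "q \<in> blocked (Suc h)"
          using later_meets[OF hm(6,7) ms] q(1) meets_gates[OF meets_lkj(2)] by blast
        then show False
          using nc qH adj_sym by (auto simp: block_def contact_def)
      qed
    qed
    then have "adj u (z (Suc h))"
      using crossing_meets_or_adj[OF hm(3,4) nr(2) IH(1)] by blast
    then show ?case using H_or by blast
  qed
  then have "adj u (z j)"
    using r by simp
  then show False
    using meets_not_near[OF meets_lkj(3)] by (simp add: near_def)
qed

text \<open>
  If on the other hand \<open>v\<close> is accessible in phase \<open>k + 1\<close>, then \<open>w\<close> must be inaccessible in phase
  \<open>k - 1\<close>, so the room of that phase is part of the room of phase \<open>k + 1\<close>. Going back in time, all
  earlier rooms are part of it too, with \<open>w\<close> and hence \<open>u\<close> inaccessible, back to phase \<open>l\<close>.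
\<close>

lemma hop_backward:
  assumes v: "z (k - 1) = v" "adj u v" and w: "z (k + 1) = w" "adj u w" and in_room: "room (k + 1) v"
  shows False
proof -
  have r: "1 \<le> l" "l \<le> k - 1" "1 \<le> k - 1" "k - 1 \<le> m" "1 \<le> k + 1" "k + 1 \<le> m"
    using lkj_range by auto
  have no_w: "\<not> room h w" if "1 \<le> h" "h \<le> k - 1" "room (k + 1) (z h)" for h
  proof
    assume "room h w"
    moreover have "h < k + 1" "\<not> k + 1 \<le> h + 1" using that r(3) by linarith+
    ultimately show False
      using jump_bound[of h "k + 1"] that r(6) w(1) by blast
  qed
  have inside: "room (k + 1) y"
    if h: "1 \<le> h" "h \<le> k - 1" "room (k + 1) (z h)" and x: "room h x" "room (k + 1) x"
      and y: "room h y" for h x y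
  proof -
    have hw: "\<not> near (z h) w"
      using room_not_near[OF h(3)] w(1) near_commute by blast
    have "\<not> near w c" if "joined (z h) x c" for c
      using room_edge[of h c w] no_w[OF h] hw room_joined[OF x(1) that] adj_sym
      unfolding near_def by blast
    then show ?thesis
      using joined_transfer rooms_joined[OF x(1) y] room_joined[OF x(2)] w(1) by blast
  qed
  have "l \<le> h \<longrightarrow> adj u (z h) \<and> room (k + 1) (z h) \<and> (\<forall>y. room h y \<longrightarrow> room (k + 1) y)"
    if "h \<le> k - 1" for h
    using that
    proof (induction h rule: inc_induct)
      case base
      have "room (k - 1) (z k)" "room (k + 1) (z k)"
        using room_next[OF r(3,4)] room_prev[OF r(5,6)] r by auto
      then show ?case
        using inside[OF r(3)] v in_room by auto
    next
      case (step h)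
      show ?case
      proof
        assume lh: "l \<le> h"
        then have IH: "adj u (z (Suc h))" "room (k + 1) (z (Suc h))"
          "\<And>y. room (Suc h) y \<Longrightarrow> room (k + 1) y"
          using step by auto
        have hm: "1 \<le> h" "h \<le> m" "1 \<le> Suc h" "Suc h \<le> m" "h \<le> k - 1"
          using step lh r by auto
        have nr: "room h (z (Suc h))" "room (Suc h) (z h)"
          using room_next[OF hm(1,2)] room_prev[OF hm(3,4)] by auto
        have zh: "room (k + 1) (z h)"
          using IH(3) nr(2) by blast
        have "\<not> meets h"
          using meets_room_neighbour[of h w] no_w[OF hm(1,5) zh] w(1,2) room_not_near[OF zh]
          by (auto simp: near_def)
        then have "adj u (z h)"
          using crossing_meets_or_adj[OF hm(1,2) nr(1) IH(1)] by blast
        then show "adj u (z h) \<and> room (k + 1) (z h) \<and> (\<forall>y. room h y \<longrightarrow> room (k + 1) y)"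
          using zh inside[OF hm(1,5) zh nr(1) IH(2)] by blast
      qed
    qed
  then have "adj u (z l)"
    using r by blast
  then show False
    using meets_not_near[OF meets_lkj(1)] by (simp add: near_def)
qed

lemma not_on_path:
  assumes "z (k - 1) \<noteq> u \<Longrightarrow> z (k + 1) \<noteq> u \<Longrightarrow> \<exists>v w. passes k v w"
  shows False
proof -
  obtain q where q: "crossing (low k) (blocked k) (k - 1) q" "q \<notin> blocked (k - 1)"
    "adj u (z (k - 1)) \<or>
     meets (k - 1) \<and> \<not> same (k - 1) k \<and> \<not> gates (k - 1) \<subseteq> blocked k"
    by (rule rise_before)
  have "\<exists>q. q \<in> gates k \<and> room (k + 1) q \<and>
    (meets (k + 1) \<or> adj u (z (k + 1)) \<and> z (k + 1) \<notin> gates k)"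
    using rise_after(2)[of k] meets_same_refl[OF meets_lkj(2)] gaps by simp
  then obtain q' where q': "q' \<in> gates k" "room (k + 1) q'"
    "meets (k + 1) \<or> adj u (z (k + 1)) \<and> z (k + 1) \<notin> gates k"
    by blast
  have "z (k - 1) \<noteq> u" "z (k + 1) \<noteq> u"
    using q(3) q'(3) meets_not_near[of "k - 1"] meets_not_near[of "k + 1"] adj_irrefl
    by (auto simp: near_def)
  then obtain v w where vw: "passes k v w"
    using assms by blast
  have qb: "q \<in> blocked k" "room (k - 1) q"
    using q(1) by (auto simp: crossing_def)
  show False
  proof (cases "meets (k - 1)")
    case True
    then have "\<not> adj u (z (k - 1))"
      using meets_not_near by (auto simp: near_def)
    then show False
      using no_start_in_component[OF vw True _ _ qb(1) q(2)] q(3) q'(3) by blast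
  next
    case False
    then have "adj u (z (k - 1))"
      using q(3) by blast
    then have v: "z (k - 1) = v"
      using vw by (auto simp: passes_def near_def)
    show False
    proof (cases "meets (k + 1)")
      case True
      then have "w \<in> gates (k + 1)" "\<not> adj v (z (k + 1))" "adj u v" "adj u w" "\<not> adj w (z k)"
        using vw meets_not_near[OF True] by (auto simp: passes_def near_def)
      then show False
        using no_stop_in_component[OF v _ _ _ _ _ qb(1) True q'(1,2)] by blast
    next
      case False
      then have "adj u (z (k + 1))"
        using q'(3) by blast
      then have w: "z (k + 1) = w"
        using vw by (auto simp: passes_def near_def)
      have vw': "adj u v" "adj u w" "\<not> adj v w" "w \<noteq> v"
        using vw by (auto simp: passes_def)
      show False
        using hop_forward[OF v vw'(1) w vw'(2-4) qb] hop_backward[OF v vw'(1) w vw'(2)] by blast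
    qed
  qed
qed

end

context observed_walk
begin

text \<open>
  Crossings of \<open>low l\<close> happen close to \<open>l\<close> only, so the distant phases \<open>k\<close> and \<open>j\<close> agree on whether
  it is occupied, and likewise \<open>l\<close> and \<open>k\<close> agree on \<open>low j\<close>. Hence \<open>k\<close> lies between \<open>l\<close> and \<open>j\<close>
  not only in time.
\<close>

lemma middle_between:
  assumes ms: "meets l" "meets k" "meets j" and gaps: "l + 3 \<le> k" "k + 3 \<le> j"
    and lj: "gates l \<subseteq> blocked j"
  shows "gates l \<subseteq> blocked k" "gates k \<subseteq> blocked j"
proof -
  have ns: "\<not> same l k" "\<not> same k j" "\<not> same l j"
    using same_close ms gaps by fastforce+
  have jl: "\<not> gates j \<subseteq> blocked l"
    using not_mutually_blocked[OF ms(1,3) _ ns(3) lj] gaps by auto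
  have r: "1 \<le> l" "l \<le> k" "k \<le> m" "1 \<le> k" "k \<le> j" "j \<le> m" "room l u" "room k u" "room j u"
    using ms gaps by (auto simp: meets_def)
  note far = meets_not_near[OF ms(1)] meets_not_near[OF ms(2)] meets_not_near[OF ms(3)]
  have "\<not> gates k \<subseteq> blocked l"
  proof
    assume "gates k \<subseteq> blocked l"
    then have "(z k \<in> low l \<or> u \<in> low l) \<noteq> (z j \<in> low l \<or> u \<in> low l)"
      using low_iff[OF far(2), of l] low_iff[OF far(3), of l] ns(1) jl u_not_low by blast
    then obtain i q where i: "k \<le> i" "i \<le> j" "crossing (low l) (blocked l) i q"
      using low_crossing_exists[OF r(4-6,8,9)] by blast
    show False
      using low_crossing_close[OF ms(1) _ _ i(3)] i r gaps by auto
  qed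
  then show "gates l \<subseteq> blocked k"
    using comparable[OF ms(1,2) ns(1)] gaps by auto
  have "\<not> same j l" "\<not> same j k"
    using ns joined_sym by blast+
  note lows = low_iff[OF far(1), of j] low_iff[OF far(2), of j] this
  show "gates k \<subseteq> blocked j"
  proof (rule ccontr)
    assume "\<not> gates k \<subseteq> blocked j"
    then have "(z l \<in> low j \<or> u \<in> low j) \<noteq> (z k \<in> low j \<or> u \<in> low j)"
      using lows lj u_not_low by blast
    then obtain i q where i: "l \<le> i" "i \<le> k" "crossing (low j) (blocked j) i q"
      using low_crossing_exists[OF r(1-3,7,8)] by blast
    show False
      using low_crossing_close[OF ms(3) _ _ i(3)] i r gaps by auto
  qed
qed

lemma not_on_path_of_ascent:
  assumes ms: "meets l" "meets k" "meets j" and gaps: "l + 3 \<le> k" "k + 3 \<le> j"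
    and lj: "gates l \<subseteq> blocked j"
    and path: "z (k - 1) \<noteq> u \<Longrightarrow> z (k + 1) \<noteq> u \<Longrightarrow> \<exists>v w. passes k v w"
  shows False
proof -
  interpret ascent adj z m u l k j
    using ms gaps middle_between[OF ms gaps lj] by unfold_locales
  show False
    using not_on_path path by blast
qed

text \<open>
  Read backwards, a walk without shortcuts is again one, and a descent becomes an ascent.
\<close>

lemma reversed: "observed_walk adj (\<lambda>i. z (m + 1 - i)) m"
proof
  fix i j :: nat and x assume i: "1 \<le> i"
  {
    assume im: "i \<le> m"
    have "1 \<le> m + 1 - i" "m + 1 - i \<le> m"
      "m + 1 - i - 1 = m + 1 - (i + 1)" "m + 1 - i + 1 = m + 1 - (i - 1)"
      using i im by auto
    then show "joined (z (m + 1 - i)) (z (m + 1 - (i - 1))) (z (m + 1 - (i + 1)))"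
      using walk[of "m + 1 - i"] joined_sym by metis
  }
  assume ij: "i < j" "j \<le> m"
  define i' j' where "i' = m + 1 - i" and "j' = m + 1 - j"
  have r: "1 \<le> j'" "j' < i'" "i' \<le> m"
    using i ij by (auto simp: i'_def j'_def)
  have shift: "m + 1 - (i - 1) = i' + 1" "m + 1 - (j + 1) = j' - 1"
    using i ij by (auto simp: i'_def j'_def)
  {
    assume "joined (z (m + 1 - i)) (z (m + 1 - (i - 1))) (z (m + 1 - j))"
      "joined (z (m + 1 - j)) (z (m + 1 - i)) (z (m + 1 - (j + 1)))"
    then have "i' \<le> j' + 1"
      using no_jump[OF r] joined_sym unfolding shift i'_def[symmetric] j'_def[symmetric] by blast
    then show "j \<le> i + 1"
      using ij by (auto simp: i'_def j'_def)
  next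
    assume "joined (z (m + 1 - i)) (z (m + 1 - (i - 1))) x"
      "joined x (z (m + 1 - i)) (z (m + 1 - j))"
      "joined (z (m + 1 - j)) x (z (m + 1 - (j + 1)))"
    then have "i' \<le> j' + 2"
      using no_bridge[OF r] joined_sym unfolding shift i'_def[symmetric] j'_def[symmetric] by blast
    then show "j \<le> i + 2"
      using ij by (auto simp: i'_def j'_def)
  }
qed

theorem not_on_path_between:
  assumes ms: "meets l" "meets k" "meets j" and gaps: "l + 3 \<le> k" "k + 3 \<le> j"
    and path: "z (k - 1) \<noteq> u \<Longrightarrow> z (k + 1) \<noteq> u \<Longrightarrow> \<exists>v w. passes k v w"
  shows False
proof -
  have "\<not> same l j"
    using same_close[OF ms(1,3)] gaps by fastforce
  then consider "gates l \<subseteq> blocked j" | "gates j \<subseteq> blocked l"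
    using comparable[OF ms(1,3)] gaps by fastforce
  then show False
  proof cases
    case 1
    then show False
      using not_on_path_of_ascent[OF ms gaps] path by blast
  next
    case 2
    interpret rev: observed_walk adj "\<lambda>i. z (m + 1 - i)" m u
      by (rule reversed)
    have meets_rev: "rev.meets (m + 1 - i)" if "meets i" for i
    proof -
      have i: "1 \<le> i" "i \<le> m" "room i u"
        using that by (auto simp: meets_def)
      have "joined (z i) (z (i - 1)) u"
        using rooms_joined[OF room_prev[OF i(1,2)] i(3)] .
      moreover have "m + 1 - (m + 1 - i) = i" "m + 1 - (m + 1 - i + 1) = i - 1"
        using i by auto
      ultimately show ?thesis
        using i unfolding rev.meets_def rev.room_def by auto
    qed
    have r: "1 \<le> l" "j \<le> m"
      using ms meets_range by auto
    have twice: "m + 1 - (m + 1 - j) = j" "m + 1 - (m + 1 - l) = l" "m + 1 - (m + 1 - k) = k"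
      "m + 1 - (m + 1 - k - 1) = k + 1" "m + 1 - (m + 1 - k + 1) = k - 1"
      using r gaps by auto
    have "rev.passes (m + 1 - k) w v" if "passes k v w" for v w
      using that adj_sym unfolding rev.passes_def passes_def twice by blast
    moreover have "m + 1 - j + 3 \<le> m + 1 - k" "m + 1 - k + 3 \<le> m + 1 - l"
      using r gaps by auto
    note rev.not_on_path_of_ascent[OF meets_rev[OF ms(3)] meets_rev[OF ms(2)]
      meets_rev[OF ms(1)] this]
    ultimately show False
      using path 2 unfolding twice by blast
  qed
qed

end

section \<open>Walks of least cost\<close>

context simple_graph
begin

definition distance :: "'a \<Rightarrow> 'a \<Rightarrow> 'a \<Rightarrow> nat" where
  "distance w x y = (LEAST n. (hop w ^^ n) x y)"

definition geodesic :: "'a \<Rightarrow> 'a \<Rightarrow> 'a \<Rightarrow> (nat \<Rightarrow> 'a) \<Rightarrow> bool" where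
  "geodesic w x y p \<longleftrightarrow> p 0 = x \<and> p (distance w x y) = y \<and>
    (\<forall>t < distance w x y. hop w (p t) (p (Suc t)))"

lemma distance_le: "(hop w ^^ n) x y \<Longrightarrow> distance w x y \<le> n"
  unfolding distance_def by (rule Least_le)

lemma geodesic_exists:
  assumes "joined w x y"
  shows "\<exists>p. geodesic w x y p"
proof -
  have "\<exists>n. (hop w ^^ n) x y"
    using assms by (simp add: joined_def rtranclp_power)
  then have "(hop w ^^ distance w x y) x y"
    unfolding distance_def by (rule LeastI_ex)
  then show ?thesis
    unfolding relpowp_fun_conv geodesic_def by blast
qed

lemma geodesic_segment:
  assumes p: "geodesic w x y p" and "s \<le> t" "t \<le> distance w x y"
  shows "(hop w ^^ (t - s)) (p s) (p t)"
  using assms(2,3)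
proof (induction t rule: dec_induct)
  case base
  show ?case by simp
next
  case (step t)
  then have "(hop w ^^ (t - s)) (p s) (p t)" "hop w (p t) (p (Suc t))"
    using p by (auto simp: geodesic_def)
  then show ?case
    using step by (auto simp: Suc_diff_le)
qed

lemma geodesic_joined:
  assumes "geodesic w x y p" "\<not> near w x" "t \<le> distance w x y"
  shows "joined w x (p t)"
proof -
  have "(hop w ^^ t) x (p t)"
    using geodesic_segment[OF assms(1) _ assms(3), of 0] assms(1) by (auto simp: geodesic_def)
  then show ?thesis
    using assms(2) relpowp_imp_rtranclp by (auto simp: joined_def)
qed

lemma geodesic_prefix:
  assumes "geodesic w x y p" "t \<le> distance w x y"
  shows "distance w x (p t) \<le> t"
  using geodesic_segment[OF assms(1) _ assms(2), of 0] assms(1) distance_le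
  by (auto simp: geodesic_def)

lemma geodesic_shortcut:
  assumes p: "geodesic w x y p" and st: "s \<le> t" "t \<le> distance w x y"
    and short: "(hop w ^^ n) (p s) (p t)"
  shows "t - s \<le> n"
proof -
  have "(hop w ^^ s) x (p s)" "(hop w ^^ (distance w x y - t)) (p t) y"
    using geodesic_segment[OF p, of 0 s] geodesic_segment[OF p st(2)] p st
    by (auto simp: geodesic_def)
  then have "(hop w ^^ (s + n + (distance w x y - t))) x y"
    using short by (auto simp: relpowp_add)
  then show ?thesis
    using distance_le st by fastforce
qed

lemma geodesic_inj:
  assumes "geodesic w x y p" "s < t" "t \<le> distance w x y"
  shows "p s \<noteq> p t"
  using geodesic_shortcut[OF assms(1) _ assms(3), of s 0] assms(2) by auto

lemma geodesic_induced:
  assumes p: "geodesic w x y p" "\<not> near w x" and st: "s + 2 \<le> t" "t \<le> distance w x y"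
  shows "\<not> adj (p s) (p t)"
proof
  assume "adj (p s) (p t)"
  then have "hop w (p s) (p t)"
    using geodesic_joined[OF p, of s] geodesic_joined[OF p, of t] joined_not_near st
    by (auto simp: hop_def)
  then have "(hop w ^^ 1) (p s) (p t)"
    unfolding relpowp_1 .
  from geodesic_shortcut[OF p(1) _ st(2) this] st show False
    by simp
qed

definition walk_between :: "'a set \<Rightarrow> 'a set \<Rightarrow> (nat \<Rightarrow> 'a) \<Rightarrow> nat \<Rightarrow> bool" where
  "walk_between I J z m \<longleftrightarrow> {z 0, z 1} = I \<and> {z m, z (m + 1)} = J \<and>
    (\<forall>i. 1 \<le> i \<longrightarrow> i \<le> m \<longrightarrow> joined (z i) (z (i - 1)) (z (i + 1)))"

text \<open>
  Comparing costs by \<^const>\<open>lenlex\<close> minimises the number of phases first. The lengths of the phases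
  are compared lexicographically, not summed up: parking a token at another vertex changes the
  lengths of three phases, and the first of them must decide however long the other two become.
\<close>

definition cost :: "(nat \<Rightarrow> 'a) \<Rightarrow> nat \<Rightarrow> nat list" where
  "cost z m = map (\<lambda>i. distance (z i) (z (i - 1)) (z (i + 1))) [1..<m + 1]"

lemma cost_length [simp]: "length (cost z m) = m"
  by (simp add: cost_def)

lemma cost_nth: "i < m \<Longrightarrow> cost z m ! i = distance (z (i + 1)) (z i) (z (i + 2))"
  by (simp add: cost_def del: upt_Suc)

end

locale optimal_walk = simple_graph adj
  for adj :: "'a \<Rightarrow> 'a \<Rightarrow> bool" +
  fixes z :: "nat \<Rightarrow> 'a" and m :: nat and I J :: "'a set"
  assumes walk_IJ: "walk_between I J z m"
    and optimal: "walk_between I J z' m' \<Longrightarrow> (cost z' m', cost z m) \<notin> lenlex less_than"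
begin

lemma phase_joined: "1 \<le> i \<Longrightarrow> i \<le> m \<Longrightarrow> joined (z i) (z (i - 1)) (z (i + 1))"
  using walk_IJ by (simp add: walk_between_def)

lemma fewest_phases: "walk_between I J z' m' \<Longrightarrow> m \<le> m'"
  using optimal[of z' m'] by (auto simp: lenlex_conv not_less)

end

sublocale optimal_walk \<subseteq> tight_walk
proof
  fix i j :: nat and x assume i: "1 \<le> i"
  {
    assume "i \<le> m"
    then show "joined (z i) (z (i - 1)) (z (i + 1))"
      using i phase_joined by blast
  next
    assume ij: "i < j" "j \<le> m"
      and jump: "joined (z i) (z (i - 1)) (z j)" "joined (z j) (z i) (z (j + 1))"
    define d where "d = j - i - 1"
    define z' where "z' h = (if h \<le> i then z h else z (h + d))" for h
    have j: "j = i + 1 + d"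
      using ij by (simp add: d_def)
    have "joined (z' h) (z' (h - 1)) (z' (h + 1))" if h: "1 \<le> h" "h \<le> m - d" for h
    proof -
      consider "h < i" | "h = i" | "h = i + 1" | "i + 1 < h" by linarith
      then show ?thesis
      proof cases
        case 1
        then have "h - 1 \<le> i" by simp
        then show ?thesis using 1 phase_joined[of h] h ij by (simp add: z'_def)
      next
        case 2
        then show ?thesis using jump(1) i j by (simp add: z'_def)
      next
        case 3
        then show ?thesis using jump(2) j by (simp add: z'_def)
      next
        case 4
        then have "h + d - 1 = h - 1 + d" "\<not> h - 1 \<le> i" by auto
        then show ?thesis using phase_joined[of "h + d"] 4 h ij j by (simp add: z'_def)
      qed
    qed
    then have "walk_between I J z' (m - d)"
      using walk_IJ i ij j by (auto simp: walk_between_def z'_def)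
    then show "j \<le> i + 1"
      using fewest_phases ij j by fastforce
  next
    assume ij: "i < j" "j \<le> m"
      and bridge: "joined (z i) (z (i - 1)) x" "joined x (z i) (z j)" "joined (z j) x (z (j + 1))"
    show "j \<le> i + 2"
    proof (rule ccontr)
      assume "\<not> j \<le> i + 2"
      define d where "d = j - i - 2"
      define z' where "z' h = (if h \<le> i then z h else if h = i + 1 then x else z (h + d))" for h
      have j: "j = i + 2 + d" "0 < d"
        using \<open>\<not> j \<le> i + 2\<close> by (simp_all add: d_def)
      have "joined (z' h) (z' (h - 1)) (z' (h + 1))" if h: "1 \<le> h" "h \<le> m - d" for h
      proof -
        consider "h < i" | "h = i" | "h = i + 1" | "h = i + 2" | "i + 2 < h" by linarith
        then show ?thesis
        proof cases
          case 1
          then have "h - 1 \<le> i" by simp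
          then show ?thesis using 1 phase_joined[of h] h ij by (simp add: z'_def)
        next
          case 2
          then show ?thesis using bridge(1) i by (simp add: z'_def)
        next
          case 3
          then show ?thesis using bridge(2) j by (simp add: z'_def)
        next
          case 4
          then show ?thesis using bridge(3) j by (simp add: z'_def)
        next
          case 5
          then have "h + d - 1 = h - 1 + d" "\<not> h - 1 \<le> i" "h - 1 \<noteq> i + 1" by auto
          then show ?thesis using phase_joined[of "h + d"] 5 h ij j by (simp add: z'_def)
        qed
      qed
      then have "walk_between I J z' (m - d)"
        using walk_IJ i ij j by (auto simp: walk_between_def z'_def)
      then show False
        using fewest_phases ij j by fastforce
    qed
  }
qed

context optimal_walk
begin

text \<open>
  Parking at \<open>u\<close> instead of \<open>z (i + 1)\<close> affects phase \<open>i\<close> and the two after it, so it must not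
  shorten phase \<open>i\<close>.
\<close>

lemma no_repark:
  assumes i: "1 \<le> i" "i + 2 \<le> m"
    and u: "joined (z i) (z (i - 1)) u" "joined u (z i) (z (i + 2))"
      "joined (z (i + 2)) u (z (i + 3))"
  shows "distance (z i) (z (i - 1)) (z (i + 1)) \<le> distance (z i) (z (i - 1)) u"
proof (rule ccontr)
  assume less: "\<not> ?thesis"
  define z' where "z' = z(i + 1 := u)"
  have "joined (z' h) (z' (h - 1)) (z' (h + 1))" if h: "1 \<le> h" "h \<le> m" for h
  proof -
    consider "h = i" | "h = i + 1" | "h = i + 2" | "h \<noteq> i" "h \<noteq> i + 1" "h \<noteq> i + 2" by blast
    then show ?thesis
      using u phase_joined[OF h] i h by cases (auto simp: z'_def eval_nat_numeral)
  qed
  then have "walk_between I J z' m"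
    using walk_IJ i by (auto simp: walk_between_def z'_def)
  moreover have "(cost z' m, cost z m) \<in> lenlex less_than"
  proof -
    have i1: "i - 1 < m" "i - 1 + 1 = i"
      using i by auto
    have "take (i - 1) (cost z' m) = take (i - 1) (cost z m)"
      using i by (auto intro!: nth_equalityI simp: cost_nth z'_def)
    moreover have "cost z' m ! (i - 1) < cost z m ! (i - 1)"
      using less i i1 by (simp add: cost_nth z'_def)
    moreover have split: "cost y m = take (i - 1) (cost y m) @ cost y m ! (i - 1) # drop i (cost y m)"
      for y
      using id_take_nth_drop[of "i - 1" "cost y m"] i1 by simp
    ultimately show ?thesis
      unfolding lenlex_conv lex_conv using i1
      by simp (metis split)
  qed
  ultimately show False
    using optimal by blast
qed

end

section \<open>Counting visits\<close>

context optimal_walk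
begin

definition len :: "nat \<Rightarrow> nat" where
  "len i = distance (z i) (z (i - 1)) (z (i + 1))"

definition path :: "nat \<Rightarrow> nat \<Rightarrow> 'a" where
  "path i = (SOME p. geodesic (z i) (z (i - 1)) (z (i + 1)) p)"

text \<open>
  A token that is parked at \<open>u\<close> and later moves on visits \<open>u\<close> once, but \<open>u\<close> is on the paths of two
  phases; only the one that ends at \<open>u\<close> is an arrival. A token that leaves its initial position
  never arrived there.
\<close>

definition visited :: "'a \<Rightarrow> nat set" where
  "visited u = {i \<in> {1..m}. u \<in> path i ` {..len i}}"

definition arrivals :: "'a \<Rightarrow> nat set" where
  "arrivals u = {i \<in> {1..m}. u \<in> path i ` {1..len i}}"

lemma path_geodesic:
  assumes "1 \<le> i" "i \<le> m"
  shows "geodesic (z i) (z (i - 1)) (z (i + 1)) (path i)"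
  unfolding path_def using geodesic_exists[OF walk[OF assms]] by (rule someI_ex)

lemma path_ends:
  assumes "1 \<le> i" "i \<le> m"
  shows "path i 0 = z (i - 1)" "path i (len i) = z (i + 1)"
  using path_geodesic[OF assms] by (auto simp: geodesic_def len_def)

lemma path_joined:
  assumes "1 \<le> i" "i \<le> m" "t \<le> len i"
  shows "joined (z i) (z (i - 1)) (path i t)"
  using geodesic_joined[OF path_geodesic[OF assms(1,2)] joined_not_near(1)[OF walk[OF assms(1,2)]]]
    assms(3) by (simp add: len_def)

lemma path_inj:
  assumes "1 \<le> i" "i \<le> m" "s < t" "t \<le> len i"
  shows "path i s \<noteq> path i t"
  using geodesic_inj[OF path_geodesic[OF assms(1,2)] assms(3)] assms(4) by (simp add: len_def)

lemma path_adj: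
  assumes "1 \<le> i" "i \<le> m" "t < len i"
  shows "adj (path i t) (path i (Suc t))"
  using path_geodesic[OF assms(1,2)] assms(3) by (simp add: geodesic_def len_def hop_def)

lemma path_induced:
  assumes "1 \<le> i" "i \<le> m" "s + 2 \<le> t" "t \<le> len i"
  shows "\<not> adj (path i s) (path i t)"
  using geodesic_induced[OF path_geodesic[OF assms(1,2)] _ assms(3)]
    joined_not_near(1)[OF walk[OF assms(1,2)]] assms(4) by (simp add: len_def)

lemma path_stretch:
  assumes i: "1 \<le> i" "i \<le> m" and st: "s \<le> t" "t \<le> len i"
    and far: "\<And>r. s \<le> r \<Longrightarrow> r \<le> t \<Longrightarrow> \<not> near u (path i r)"
  shows "joined u (path i s) (path i t)"
  using st far
proof (induction t rule: dec_induct)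
  case base
  then show ?case using joined_refl by simp
next
  case (step t)
  then show ?case
    using joined_edge[of u "path i s" "path i t" "path i (Suc t)"] path_adj[OF i, of t] by simp
qed

lemma visited_meets:
  assumes "i \<in> visited u"
  shows "observed_walk.meets adj z m u i"
proof -
  interpret observed_walk adj z m u ..
  have i: "1 \<le> i" "i \<le> m"
    using assms by (auto simp: visited_def)
  have "joined (z i) (z (i - 1)) u"
    using assms path_joined[OF i] by (auto simp: visited_def)
  then show ?thesis
    using i room_joined[OF room_prev[OF i]] by (simp add: meets_def)
qed

lemma visited_passes:
  assumes "i \<in> visited u" and ends: "z (i - 1) \<noteq> u" "z (i + 1) \<noteq> u"
  shows "\<exists>v w. observed_walk.passes adj z u i v w"
proof -
  interpret observed_walk adj z m u ..
  have i: "1 \<le> i" "i \<le> m"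
    using assms by (auto simp: visited_def)
  obtain t where t: "t \<le> len i" "path i t = u"
    using assms(1) by (auto simp: visited_def)
  have t0: "0 < t" "t < len i"
    using t ends path_ends[OF i] by (cases "t = 0"; cases "t = len i"; auto)+
  define v w where "v = path i (t - 1)" and "w = path i (t + 1)"
  have uv: "adj u v" "adj u w"
    using path_adj[OF i, of "t - 1"] path_adj[OF i, of t] t t0 adj_sym[of v u]
    by (auto simp: v_def w_def)
  have far: "\<not> near u (path i r)" if "r \<le> len i" "r + 2 \<le> t \<or> t + 2 \<le> r" for r
  proof -
    have "\<not> adj u (path i r)" "path i r \<noteq> u"
      using path_induced[OF i, of r t] path_induced[OF i, of t r] path_inj[OF i, of r t]
        path_inj[OF i, of t r] that t adj_sym[of u "path i r"] by auto
    then show ?thesis by (simp add: near_def)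
  qed
  have "v \<noteq> w" "\<not> adj v w"
    using path_inj[OF i, of "t - 1" "t + 1"] path_induced[OF i, of "t - 1" "t + 1"] t0
    by (auto simp: v_def w_def)
  moreover have "\<not> adj v (z i)" "\<not> adj w (z i)"
    using not_nearD[OF joined_not_near(2)[OF path_joined[OF i, of "t - 1"]]]
      not_nearD[OF joined_not_near(2)[OF path_joined[OF i, of "t + 1"]]] t0
    by (auto simp: v_def w_def)
  moreover have "z (i - 1) = v \<or>
    \<not> near u (z (i - 1)) \<and> v \<in> gates (i - 1) \<and> \<not> adj w (z (i - 1))"
  proof (cases "t = 1")
    case True
    then show ?thesis using path_ends[OF i] by (simp add: v_def)
  next
    case False
    then have t2: "2 \<le> t" using t0 by simp
    have "\<not> near u (path i r)" if "r \<le> t - 2" for r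
      by (rule far) (use that t t2 in linarith)+
    then have "joined u (path i 0) (path i (t - 2))"
      using path_stretch[OF i, of 0 "t - 2"] t by simp
    moreover have "Suc (t - 2) = t - 1"
      using t2 by simp
    then have "adj v (path i (t - 2))"
      using path_adj[OF i, of "t - 2"] t t2 adj_sym[of "path i (t - 2)" v] by (simp add: v_def)
    moreover have "\<not> adj w (path i 0)"
      using path_induced[OF i, of 0 "t + 1"] t0 adj_sym[of w "path i 0"] by (auto simp: w_def)
    ultimately show ?thesis
      using far[of 0] t2 uv path_ends[OF i] unfolding gate_def by auto
  qed
  moreover have "z (i + 1) = w \<or>
    \<not> near u (z (i + 1)) \<and> w \<in> gates (i + 1) \<and> \<not> adj v (z (i + 1))"
  proof (cases "t + 1 = len i")
    case True
    then show ?thesis using path_ends[OF i] by (simp add: w_def)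
  next
    case False
    then have t2: "t + 2 \<le> len i" using t0 by simp
    have "\<not> near u (path i r)" if "t + 2 \<le> r" "r \<le> len i" for r
      using far that by blast
    then have "joined u (path i (t + 2)) (path i (len i))"
      using path_stretch[OF i t2] by blast
    then have "joined u (path i (len i)) (path i (t + 2))"
      by (rule joined_sym)
    moreover have "adj w (path i (t + 2))"
      using path_adj[OF i, of "t + 1"] t2 by (simp add: w_def)
    moreover have "\<not> adj v (path i (len i))"
      using path_induced[OF i, of "t - 1" "len i"] t0 by (auto simp: v_def)
    ultimately show ?thesis
      using far[of "len i"] t2 uv path_ends[OF i] unfolding gate_def by auto
  qed
  ultimately show ?thesis
    using uv unfolding passes_def by blast
qed

text \<open>
  If three consecutive phases visit \<open>u\<close>, then by comparability the tokens parked in the first and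
  the third phase share a component of \<open>G - N[u]\<close>. Parking at \<open>u\<close> in the second phase instead ends
  the first phase earlier.
\<close>

lemma not_three_consecutive:
  assumes "i \<in> visited u" "i + 1 \<in> visited u" "i + 2 \<in> visited u"
  shows False
proof -
  interpret observed_walk adj z m u ..
  have i: "1 \<le> i" "i + 2 \<le> m" "i \<le> m"
    using assms by (auto simp: visited_def)
  have ms: "meets i" "meets (i + 1)" "meets (i + 2)"
    using assms visited_meets by auto
  note far = meets_not_near[OF ms(1)] meets_not_near[OF ms(2)] meets_not_near[OF ms(3)]
  obtain v w where vw: "passes (i + 1) v w"
    using visited_passes[OF assms(2)] far by (auto simp: near_def)
  have gates: "v \<in> gates i" "w \<in> gates (i + 2)" "w \<notin> blocked i" "v \<notin> blocked (i + 2)"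
    using vw far by (auto simp: passes_def near_def block_def)
  have same: "same i (i + 2)"
    using comparable[OF ms(1,3)] gates by auto
  obtain t where t: "t \<le> len i" "path i t = u"
    using assms(1) by (auto simp: visited_def)
  have "t \<noteq> len i"
    using t path_ends(2)[OF i(1,3)] far by (auto simp: near_def)
  moreover have "distance (z i) (z (i - 1)) u \<le> t"
    using geodesic_prefix[OF path_geodesic[OF i(1,3)], of t] t by (simp add: len_def)
  ultimately have shorter: "distance (z i) (z (i - 1)) u < len i"
    using t by simp
  have "joined (z i) (z (i - 1)) u"
    using path_joined[OF i(1,3) t(1)] t by simp
  moreover have "joined (z (i + 2)) u (z (i + 3))"
    using rooms_joined[OF meets_room[OF ms(3)] room_next[of "i + 2"]] i by (simp add: eval_nat_numeral)
  ultimately show False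
    using no_repark[OF i(1,2) _ same] shorter by (simp add: len_def)
qed

end

text \<open>
  The first, the third and the fifth element are as required.
\<close>

lemma distant_elements:
  fixes A :: "nat set"
  assumes "finite A" "5 \<le> card A" and "\<And>i. \<not> (i \<in> A \<and> i + 1 \<in> A \<and> i + 2 \<in> A)"
  obtains l k j where "l \<in> A" "k \<in> A" "j \<in> A" "l + 3 \<le> k" "k + 3 \<le> j"
proof -
  define xs where "xs = sorted_list_of_set A"
  have len: "5 \<le> length xs" and set: "set xs = A"
    using assms by (auto simp: xs_def)
  have inA: "xs ! n \<in> A" if "n < 5" for n
    using that len set nth_mem[of n xs] by auto
  have incr: "xs ! n < xs ! Suc n" if "n < 4" for n
    using sorted_wrt_nth_less[of "(<)" xs n "Suc n"] that len by (simp add: xs_def)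
  have gap: "xs ! n + 3 \<le> xs ! (n + 2)" if "n < 3" for n
  proof (rule ccontr)
    assume "\<not> ?thesis"
    then have "xs ! (n + 1) = xs ! n + 1" "xs ! (n + 2) = xs ! n + 2"
      using incr[of n] incr[of "n + 1"] that by auto
    then show False
      using assms(3)[of "xs ! n"] inA[of n] inA[of "n + 1"] inA[of "n + 2"] that by auto
  qed
  show thesis
    by (rule that[OF inA[of 0] inA[of 2] inA[of 4]])
      (use gap[of 0] gap[of 2] in \<open>simp_all add: eval_nat_numeral\<close>)
qed

context optimal_walk
begin

lemma finite_visited: "finite (visited u)"
  by (simp add: visited_def)

lemma card_visited: "card (visited u) \<le> 4"
proof (rule ccontr)
  interpret observed_walk adj z m u ..
  assume "\<not> ?thesis"
  then have "5 \<le> card (visited u)" by simp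
  then obtain l k j where lkj: "l \<in> visited u" "k \<in> visited u" "j \<in> visited u"
    "l + 3 \<le> k" "k + 3 \<le> j"
    using distant_elements[OF finite_visited, of u] not_three_consecutive by blast
  show False
    by (rule not_on_path_between[OF lkj(1-3)[THEN visited_meets] lkj(4,5)])
      (rule visited_passes[OF lkj(2)])
qed

text \<open>
  If \<open>u\<close> is one of the initial positions, the phase in which its token leaves compensates for the
  initial visit: it is in \<open>visited u\<close>, but no arrival.
\<close>

lemma visits_bound: "of_bool (u \<in> {z 0, z 1}) + card (arrivals u) \<le> 4"
proof -
  have sub: "arrivals u \<subseteq> visited u"
    by (auto simp: arrivals_def visited_def)
  have not_arrival: "i \<in> visited u" "i \<notin> arrivals u" if i: "1 \<le> i" "i \<le> m" "u = z (i - 1)" for i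
  proof -
    have "path i 0 = u"
      using path_ends(1)[OF i(1,2)] i(3) by simp
    moreover have "path i 0 \<noteq> path i t" if "1 \<le> t" "t \<le> len i" for t
      using path_inj[OF i(1,2), of 0 t] that by simp
    ultimately show "i \<in> visited u" "i \<notin> arrivals u"
      using i(1,2) by (fastforce simp: arrivals_def visited_def)+
  qed
  have "\<exists>i. i \<in> visited u - arrivals u" if u: "u \<in> {z 0, z 1}" and "arrivals u \<noteq> {}"
  proof -
    obtain i where i: "i \<in> arrivals u" "1 \<le> i" "i \<le> m"
      using \<open>arrivals u \<noteq> {}\<close> by (auto simp: arrivals_def)
    show ?thesis
    proof (cases "u = z 0")
      case True
      then show ?thesis using not_arrival[of 1] i by auto
    next
      case False
      interpret observed_walk adj z m u ..
      have "1 \<notin> visited u"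
        using visited_meets[of 1 u] meets_not_near[of 1] u False by auto
      then have "2 \<le> m"
        using sub i by (cases "i = 1") auto
      then show ?thesis using not_arrival[of 2] u False by auto
    qed
  qed
  then have "arrivals u \<noteq> {} \<Longrightarrow> u \<in> {z 0, z 1} \<Longrightarrow> card (arrivals u) < card (visited u)"
    using psubset_card_mono[OF finite_visited, of "arrivals u" u] sub by blast
  then show ?thesis
    using card_visited[of u] card_mono[OF finite_visited sub]
    by (cases "arrivals u = {}"; cases "u \<in> {z 0, z 1}") auto
qed

end

section \<open>From reconfiguration sequences to walks and back\<close>

context simple_graph
begin

text \<open>
  Parked and moving token alternate in a walk. If the token that moves next also moved in the last
  phase, a phase in which the other token stays where it is restores the alternation.
\<close>

lemma walk_extend:
  assumes w: "walk_between I {p, x} z m" and pq: "joined x p q"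
  shows "\<exists>z' m'. walk_between I {x, q} z' m'"
proof -
  have extend: "walk_between I {y, r} (z(m + 2 := r)) (m + 1)"
    if "walk_between I J z m" "z (m + 1) = y" "joined y (z m) r" for J z m y r
    using that by (auto simp: walk_between_def le_Suc_eq)
  have "{z m, z (m + 1)} = {p, x}"
    using w by (simp add: walk_between_def)
  then consider "z m = p" "z (m + 1) = x" | "z m = x" "z (m + 1) = p"
    by (auto simp: doubleton_eq_iff)
  then show ?thesis
  proof cases
    case 1
    then show ?thesis using extend[OF w] pq by blast
  next
    case 2
    define z' where "z' = z(m + 2 := x)"
    have "\<not> near p x"
      using joined_not_near(1)[OF pq] near_commute by blast
    then have "walk_between I {p, x} z' (m + 1)"
      using extend[OF w 2(2), of x] 2(1) joined_refl by (simp add: z'_def)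
    moreover have "z' (m + 1) = p" "z' (m + 1 + 1) = x"
      using 2 by (simp_all add: z'_def)
    ultimately show ?thesis
      using extend[of "{p, x}" z' "m + 1" x q] pq by auto
  qed
qed

lemma optimal_walk_exists:
  assumes "walk_between I J z m"
  shows "\<exists>z m. optimal_walk adj z m I J"
proof -
  define Q where "Q = {cost z m | z m. walk_between I J z m}"
  obtain c where c: "c \<in> Q" "\<And>c'. (c', c) \<in> lenlex less_than \<Longrightarrow> c' \<notin> Q"
    using wfE_min[OF wf_lenlex[OF wf_less_than], of "cost z m" Q] assms by (auto simp: Q_def)
  obtain z m where zm: "c = cost z m" "walk_between I J z m"
    using c(1) by (auto simp: Q_def)
  have "optimal_walk adj z m I J"
    by unfold_locales (use zm c(2) in \<open>auto simp: Q_def\<close>)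
  then show ?thesis by blast
qed

end

lemma visits_snoc:
  assumes "Is \<noteq> []"
  shows "visits (Is @ [J]) u = visits Is u + card ((J - last Is) \<inter> {u})"
proof -
  have "({} # Is @ [J]) ! i = ({} # Is) ! i" if "i \<le> length Is" for i
    using that by (simp add: nth_append flip: append_Cons)
  moreover have "({} # Is) ! length Is = last Is"
    using assms by (simp add: last_conv_nth nth_Cons')
  ultimately show ?thesis
    unfolding visits_def by (simp add: nth_append)
qed

lemma reconf_seq_snoc:
  assumes "reconf_seq G I J Is" "independent_set G K" "slide_step G J K"
  shows "reconf_seq G I K (Is @ [K])"
  using assms by (auto simp: reconf_seq_def successively_append_iff)

locale graph_adjacency = pair_graph G for G :: "'a pair_pre_digraph"
begin

definition adj :: "'a \<Rightarrow> 'a \<Rightarrow> bool" where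
  "adj x y \<longleftrightarrow> (x, y) \<in> parcs G"

end

sublocale graph_adjacency \<subseteq> simple_graph adj
proof
  show "adj x y \<Longrightarrow> adj y x" for x y
    using pair_sym_arcs by (auto simp: adj_def symmetric_def sym_def)
  show "\<not> adj x x" for x
    using pair_no_loops[of "(x, x)"] by (auto simp: adj_def)
qed

context graph_adjacency
begin

lemma independent_pair_iff:
  assumes "x \<noteq> y"
  shows "independent_set G {x, y} \<longleftrightarrow> x \<in> pverts G \<and> y \<in> pverts G \<and> \<not> near x y"
  using assms adj_irrefl adj_sym[of y x] by (auto simp: independent_set_def near_def adj_def)

text \<open>
  Sliding preserves the number of tokens, which makes every set of the sequence a pair.
\<close>

lemma walk_of_reconf_seq:
  assumes "Is \<noteq> []" "\<forall>J\<in>set Is. independent_set G J" "successively (slide_step G) Is"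
    and "card (hd Is) = 2"
  shows "card (last Is) = 2 \<and> (\<exists>z m. walk_between (hd Is) (last Is) z m)"
  using assms
proof (induction Is rule: rev_nonempty_induct)
  case (single I)
  then obtain x y where "I = {x, y}"
    by (auto simp: card_2_iff)
  then have "walk_between I I (\<lambda>i. if i = 0 then x else y) 0"
    by (simp add: walk_between_def)
  then show ?case using single by auto
next
  case (snoc K Is)
  have IH: "card (last Is) = 2" "\<exists>z m. walk_between (hd Is) (last Is) z m"
    and step: "slide_step G (last Is) K"
    and indep: "independent_set G (last Is)" "independent_set G K"
    using snoc by (auto simp: successively_append_iff)
  obtain p q where pq: "last Is - K = {p}" "K - last Is = {q}" "adj p q"
    using step by (auto simp: slide_step_def adj_def)
  obtain x where x: "last Is = {p, x}" "x \<noteq> p"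
  proof -
    have "p \<in> last Is" using pq(1) by blast
    then have "card (last Is - {p}) = 1"
      using IH(1) by simp
    then obtain x where "last Is - {p} = {x}"
      by (auto simp: card_1_singleton_iff)
    then show thesis
      using that[of x] \<open>p \<in> last Is\<close> by blast
  qed
  have K: "K = {x, q}" "x \<noteq> q"
    using pq x by auto
  have "\<not> near x p" "\<not> near x q"
    using indep independent_pair_iff[of x p] independent_pair_iff[of x q] x K
    by (auto simp: insert_commute)
  then have "joined x p q"
    using joined_edge[OF joined_refl] pq(3) by blast
  then have "\<exists>z m. walk_between (hd Is) {x, q} z m"
    using IH(2) walk_extend unfolding x(1) by blast
  then show ?case
    using K snoc.hyps by simp
qed

lemma slide_along_geodesic:
  assumes seq: "reconf_seq G I {w, x} Is" and p: "geodesic w x y p" "\<not> near w x"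
    and wx: "w \<in> pverts G" "x \<in> pverts G" and "t \<le> distance w x y"
  shows "\<exists>Is'. reconf_seq G I {w, p t} Is' \<and>
    (\<forall>u. visits Is' u = visits Is u + of_bool (u \<in> p ` {1..t}))"
  using assms(6)
proof (induction t)
  case 0
  then show ?case using seq p by (auto simp: geodesic_def)
next
  case (Suc t)
  then obtain Is' where Is': "reconf_seq G I {w, p t} Is'"
    "\<And>u. visits Is' u = visits Is u + of_bool (u \<in> p ` {1..t})"
    by auto
  have hop: "hop w (p t) (p (Suc t))"
    using p Suc.prems by (simp add: geodesic_def)
  have arc: "(p t, p (Suc t)) \<in> parcs G"
    using hop by (simp add: hop_def adj_def)
  have distinct: "p t \<noteq> w" "p (Suc t) \<noteq> w" "p t \<noteq> p (Suc t)"
    using hop adj_irrefl by (auto simp: hop_def near_def)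
  have "independent_set G {w, p (Suc t)}"
    using independent_pair_iff[of w "p (Suc t)"] wx(1) distinct hop in_arcsD2[OF arc]
    by (auto simp: hop_def)
  moreover have "slide_step G {w, p t} {w, p (Suc t)}"
    using distinct arc by (auto simp: slide_step_def)
  ultimately have "reconf_seq G I {w, p (Suc t)} (Is' @ [{w, p (Suc t)}])"
    using reconf_seq_snoc Is'(1) by blast
  moreover have "visits (Is' @ [{w, p (Suc t)}]) u = visits Is u + of_bool (u \<in> p ` {1..Suc t})"
    for u
  proof -
    have "Is' \<noteq> []" "last Is' = {w, p t}"
      using Is'(1) by (auto simp: reconf_seq_def)
    moreover have "{w, p (Suc t)} - {w, p t} = {p (Suc t)}"
      using distinct by auto
    moreover have "p (Suc t) \<notin> p ` {1..t}"
    proof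
      assume "p (Suc t) \<in> p ` {1..t}"
      then obtain s where "s \<le> t" "p s = p (Suc t)" by auto
      then show False
        using geodesic_inj[OF p(1) _ Suc.prems, of s] by simp
    qed
    ultimately show ?thesis
      using visits_snoc[of Is' "{w, p (Suc t)}" u] Is'(2)[of u]
      by (cases "u = p (Suc t)") (auto simp: atLeastAtMostSuc_conv)
  qed
  ultimately show ?case by blast
qed

lemma reconf_seq_of_walk:
  assumes "optimal_walk adj z m I J" and I: "independent_set G I" "card I = 2"
  shows "\<exists>Is. reconf_seq G I J Is \<and> (\<forall>u. visits Is u \<le> 4)"
proof -
  interpret optimal_walk adj z m I J
    by (rule assms(1))
  have ends: "I = {z 0, z 1}" "J = {z m, z (m + 1)}"
    using walk_IJ by (auto simp: walk_between_def)
  have "\<exists>Is. reconf_seq G I {z i, z (i + 1)} Is \<and>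
    (\<forall>u. visits Is u \<le> of_bool (u \<in> I) + card (arrivals u \<inter> {1..i}))" if "i \<le> m" for i
    using that
  proof (induction i)
    case 0
    have "reconf_seq G I I [I]"
      using I by (simp add: reconf_seq_def)
    moreover have "visits [I] u \<le> of_bool (u \<in> I)" for u
      by (simp add: visits_def)
    moreover have "{z 0, z (0 + 1)} = I" "card (arrivals u \<inter> {1..0}) = 0" for u
      using ends(1) by auto
    ultimately show ?case by (intro exI[of _ "[I]"]) simp
  next
    case (Suc i)
    then obtain Is where Is: "reconf_seq G I {z i, z (i + 1)} Is"
      "\<And>u. visits Is u \<le> of_bool (u \<in> I) + card (arrivals u \<inter> {1..i})"
      by auto
    have si: "1 \<le> Suc i" "Suc i \<le> m"
      using Suc.prems by auto
    note geo = path_geodesic[OF si]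
    have far: "\<not> near (z (Suc i)) (z i)"
      using joined_not_near(1)[OF walk[OF si]] by simp
    have "independent_set G {z i, z (i + 1)}"
      using Is(1) last_in_set[of Is] by (auto simp: reconf_seq_def)
    then have verts: "z (Suc i) \<in> pverts G" "z i \<in> pverts G"
      by (auto simp: independent_set_def)
    have "reconf_seq G I {z (Suc i), z (Suc i - 1)} Is"
      using Is(1) by (simp add: insert_commute)
    then obtain Is' where Is': "reconf_seq G I {z (Suc i), path (Suc i) (len (Suc i))} Is'"
      "\<And>u. visits Is' u = visits Is u + of_bool (u \<in> path (Suc i) ` {1..len (Suc i)})"
      using slide_along_geodesic[OF _ geo _ verts(1), of I Is "len (Suc i)"] far verts(2)
      by (auto simp: len_def)
    have "visits Is' u \<le> of_bool (u \<in> I) + card (arrivals u \<inter> {1..Suc i})" for u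
    proof -
      have "arrivals u \<inter> {1..Suc i} =
        (if u \<in> path (Suc i) ` {1..len (Suc i)} then insert (Suc i) (arrivals u \<inter> {1..i})
         else arrivals u \<inter> {1..i})"
        using si by (auto simp: arrivals_def atLeastAtMostSuc_conv)
      then show ?thesis
        using Is(2)[of u] Is'(2)[of u] by auto
    qed
    moreover have "reconf_seq G I {z (Suc i), z (Suc i + 1)} Is'"
      using Is'(1) path_ends(2)[OF si] by simp
    ultimately show ?case by blast
  qed
  from this[of m] obtain Is where Is: "reconf_seq G I J Is"
    "\<And>u. visits Is u \<le> of_bool (u \<in> I) + card (arrivals u \<inter> {1..m})"
    using ends(2) by auto
  have "arrivals u \<inter> {1..m} = arrivals u" for u
    by (auto simp: arrivals_def)
  then have "visits Is u \<le> 4" for u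
    using Is(2)[of u] visits_bound[of u] unfolding ends(1) by (metis le_trans)
  then show ?thesis
    using Is(1) by blast
qed

end

theorem theorem2:
  fixes G :: "'a pair_pre_digraph" and a b c d :: 'a
  assumes "pair_graph G"
    and "a \<noteq> b" and "independent_set G {a, b}"
    and "c \<noteq> d" and "independent_set G {c, d}"
    and "ts_reachable G {a, b} {c, d}"
  shows "\<exists>Is. reconf_seq G {a, b} {c, d} Is \<and> (\<forall>u\<in>pverts G. visits Is u \<le> 4)"
proof -
  interpret pair_graph G
    by (rule assms(1))
  interpret graph_adjacency G ..
  obtain Is where Is: "reconf_seq G {a, b} {c, d} Is"
    using assms(6) by (auto simp: ts_reachable_def)
  then have "\<exists>z m. walk_between {a, b} {c, d} z m"
    using walk_of_reconf_seq[of Is] assms(2) by (auto simp: reconf_seq_def)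
  then obtain z m where "optimal_walk adj z m {a, b} {c, d}"
    using optimal_walk_exists by blast
  then show ?thesis
    using reconf_seq_of_walk assms(2,3) by fastforce
qed

end
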